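(* Let $0<a\leq 1$, let $N\geq 1$ be an integer, $m\in\{1,\ldots,N\}$, $k\in\{1,\ldots,m+1\}$. Let $\Sigma_1$ be a simple closed contour around $a$ but not enclosing $-1/a$, and $\Sigma_2$ a simple closed contour around $\Sigma_1$ and $0$ (disjoint from $\Sigma_1$), both oriented positively. Let $$W(z)=\frac{z^{N-m}}{(z-a)^{N-m+1}(1+az)^m},\qquad K_{N,m}(n,n')=\frac{1}{(2\pi i)^2}\int_{\Sigma_2}du\int_{\Sigma_1}dv\,\frac{u^{-n-1}v^{n'}}{u-v}\,\frac{W(v)}{W(u)},\quad n,n'\in\mathbb Z.$$ Then $$\det\left(1-1_{\mathbb Z\cap[k,+\infty)}K_{N,m}\right)_{\ell^2(\mathbb Z)}=\det\left(1-\mathcal M\right)_{L^2(\Sigma_1)\oplus L^2(\Sigma_2)},$$ where the integral operator $\mathcal M:L^2(\Sigma_1)\oplus L^2(\Sigma_2)\to L^2(\Sigma_1)\oplus L^2(\Sigma_2)$ has kernel $$M(z,z')=\frac{1_{\Sigma_2}(z')1_{\Sigma_1}(z)\left(\frac{z}{z'}\right)^{k}-1_{\Sigma_1}(z')1_{\Sigma_2}(z)\frac{W(z')}{W(z)}}{2\pi i(z-z')}.$$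
   Context: $1_{\mathbb Z\cap[k,+\infty)}$ is the projection onto sequences supported on $\{k,k+1,\ldots\}$. Fredholm determinants are given by Fredholm series: $$\det(1-1_{\mathbb Z\cap[k,+\infty)}K)_{\ell^2(\mathbb Z)}=1+\sum_{p=1}^\infty\frac{(-1)^p}{p!}\sum_{n_1,\ldots,n_p\geq k}\det\left(K(n_i,n_j)\right)_{i,j=1}^p ,$$ and, identifying $L^2(\Sigma_1)\oplus L^2(\Sigma_2)$ with $L^2(\Sigma)$, $\Sigma=\Sigma_1\cup\Sigma_2$, $$\det(1-\mathcal M)_{L^2(\Sigma)}=1+\sum_{p=1}^\infty\frac{(-1)^p}{p!}\int_{\Sigma^p}\det\left(M(z_i,z_j)\right)_{i,j=1}^p\prod_{j=1}^p dz_j .$$ The operator with kernel $M$ is $\mathcal M[f](z)=\int_{\Sigma}M(z,z')f(z')\,dz'$ (complex line integral), and $M(z,z')=0$ when $z,z'$ lie on the same contour. *)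

theory Defs
  imports "HOL-Complex_Analysis.Complex_Analysis" "Jordan_Normal_Form.Determinant"
begin

definition positive_contour :: "(real \<Rightarrow> complex) \<Rightarrow> bool" where
  "positive_contour \<gamma> \<longleftrightarrow>
     valid_path \<gamma> \<and> simple_path \<gamma> \<and> pathfinish \<gamma> = pathstart \<gamma> \<and>
     (\<forall>z \<in> inside (path_image \<gamma>). winding_number \<gamma> z = 1)"

text \<open>The number \<open>det (K(x\<^sub>i, x\<^sub>j))\<close>, with indices \<open>0 \<le> i, j < p\<close>.\<close>

definition kernel_minor :: "('a \<Rightarrow> 'a \<Rightarrow> complex) \<Rightarrow> nat \<Rightarrow> (nat \<Rightarrow> 'a) \<Rightarrow> complex" where
  "kernel_minor K p x = Determinant.det (Matrix.mat p p (\<lambda>(i, j). K (x i) (x j)))"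


subsection \<open>Fredholm determinants on \<open>\<ell>\<^sup>2(\<int>)\<close>\<close>

text \<open>For \<open>J \<subseteq> \<int>\<close>, the Fredholm series of \<open>det (1 - 1\<^sub>J K)\<close>; \<open>p\<close>-tuples of elements of \<open>J\<close> are the
  extensional functions in \<open>{..<p} \<rightarrow>\<^sub>E J\<close>.\<close>

definition l2_fredholm_term :: "int set \<Rightarrow> (int \<Rightarrow> int \<Rightarrow> complex) \<Rightarrow> nat \<Rightarrow> complex" where
  "l2_fredholm_term J K p =
     (-1) ^ p / fact p * (\<Sum>\<^sub>\<infinity>n \<in> {..<p} \<rightarrow>\<^sub>E J. kernel_minor K p n)"

definition l2_fredholm_convergent :: "int set \<Rightarrow> (int \<Rightarrow> int \<Rightarrow> complex) \<Rightarrow> bool" where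
  "l2_fredholm_convergent J K \<longleftrightarrow>
     (\<forall>p \<ge> 1. kernel_minor K p summable_on ({..<p} \<rightarrow>\<^sub>E J)) \<and>
     summable (\<lambda>p. l2_fredholm_term J K (Suc p))"

definition l2_fredholm_det :: "int set \<Rightarrow> (int \<Rightarrow> int \<Rightarrow> complex) \<Rightarrow> complex" where
  "l2_fredholm_det J K = 1 + (\<Sum>p. l2_fredholm_term J K (Suc p))"


subsection \<open>Fredholm determinants on \<open>L\<^sup>2(\<Sigma>)\<close> for a union \<open>\<Sigma>\<close> of contours\<close>

text \<open>\<open>\<Sigma>\<close> is represented by the list of the (pairwise disjoint) contours it consists of.\<close>

definition contours_integral :: "(real \<Rightarrow> complex) list \<Rightarrow> (complex \<Rightarrow> complex) \<Rightarrow> complex" where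
  "contours_integral \<Gamma> f = (\<Sum>\<gamma>\<leftarrow>\<Gamma>. contour_integral \<gamma> f)"

text \<open>The complex line integral over \<open>\<Sigma>\<^sup>p\<close>, as an iterated integral: the integrand is a function of
  \<open>z 0, \<dots>, z (p - 1)\<close>, and the outermost integration is over \<open>z (p - 1)\<close>. The values \<open>z i\<close>
  with \<open>i \<ge> p\<close> are irrelevant and set to \<open>0\<close>.\<close>

primrec contours_integral_power ::
    "(real \<Rightarrow> complex) list \<Rightarrow> nat \<Rightarrow> ((nat \<Rightarrow> complex) \<Rightarrow> complex) \<Rightarrow> complex" where
  "contours_integral_power \<Gamma> 0 f = f (\<lambda>_. 0)"
| "contours_integral_power \<Gamma> (Suc p) f =
     contours_integral \<Gamma> (\<lambda>w. contours_integral_power \<Gamma> p (\<lambda>z. f (z(p := w))))"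

text \<open>All the contour integrals occurring in \<open>contours_integral_power\<close> exist.\<close>

primrec contours_power_integrable ::
    "(real \<Rightarrow> complex) list \<Rightarrow> nat \<Rightarrow> ((nat \<Rightarrow> complex) \<Rightarrow> complex) \<Rightarrow> bool" where
  "contours_power_integrable \<Gamma> 0 f \<longleftrightarrow> True"
| "contours_power_integrable \<Gamma> (Suc p) f \<longleftrightarrow>
     (\<forall>\<gamma> \<in> set \<Gamma>.
        (\<forall>w \<in> path_image \<gamma>. contours_power_integrable \<Gamma> p (\<lambda>z. f (z(p := w)))) \<and>
        (\<lambda>w. contours_integral_power \<Gamma> p (\<lambda>z. f (z(p := w)))) contour_integrable_on \<gamma>)"

definition L2_fredholm_term ::
    "(real \<Rightarrow> complex) list \<Rightarrow> (complex \<Rightarrow> complex \<Rightarrow> complex) \<Rightarrow> nat \<Rightarrow> complex" where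
  "L2_fredholm_term \<Gamma> M p =
     (-1) ^ p / fact p * contours_integral_power \<Gamma> p (kernel_minor M p)"

definition L2_fredholm_convergent ::
    "(real \<Rightarrow> complex) list \<Rightarrow> (complex \<Rightarrow> complex \<Rightarrow> complex) \<Rightarrow> bool" where
  "L2_fredholm_convergent \<Gamma> M \<longleftrightarrow>
     (\<forall>p \<ge> 1. contours_power_integrable \<Gamma> p (kernel_minor M p)) \<and>
     summable (\<lambda>p. L2_fredholm_term \<Gamma> M (Suc p))"

definition L2_fredholm_det ::
    "(real \<Rightarrow> complex) list \<Rightarrow> (complex \<Rightarrow> complex \<Rightarrow> complex) \<Rightarrow> complex" where
  "L2_fredholm_det \<Gamma> M = 1 + (\<Sum>p. L2_fredholm_term \<Gamma> M (Suc p))"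


subsection \<open>The two kernels\<close>

definition W :: "real \<Rightarrow> nat \<Rightarrow> nat \<Rightarrow> complex \<Rightarrow> complex" where
  "W a N m z = z ^ (N - m) / ((z - of_real a) ^ (N - m + 1) * (1 + of_real a * z) ^ m)"

text \<open>If \<open>\<Sigma>\<^sub>2\<close> passes through \<open>-1/a\<close>, then \<open>1 / W u\<close> has the correct value \<open>0\<close> there (for \<open>m \<ge> 1\<close>),
  because \<open>W a N m (-1/a) = 0\<close> by the convention \<open>x / 0 = 0\<close>.\<close>

definition K_kernel ::
    "(real \<Rightarrow> complex) \<Rightarrow> (real \<Rightarrow> complex) \<Rightarrow> real \<Rightarrow> nat \<Rightarrow> nat \<Rightarrow> int \<Rightarrow> int \<Rightarrow> complex" where
  "K_kernel \<gamma>1 \<gamma>2 a N m n n' =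
     1 / (2 * of_real pi * \<i>) ^ 2 *
     contour_integral \<gamma>2 (\<lambda>u. contour_integral \<gamma>1 (\<lambda>v.
       u powi (- n - 1) * v powi n' / (u - v) * (W a N m v / W a N m u)))"

text \<open>For \<open>z, z'\<close> on the same contour (in particular for \<open>z = z'\<close>) the value is \<open>0\<close>, provided the two
  contours are disjoint.\<close>

definition M_kernel ::
    "(real \<Rightarrow> complex) \<Rightarrow> (real \<Rightarrow> complex) \<Rightarrow> real \<Rightarrow> nat \<Rightarrow> nat \<Rightarrow> nat \<Rightarrow> complex \<Rightarrow> complex \<Rightarrow> complex"
  where
  "M_kernel \<gamma>1 \<gamma>2 a N m k z z' =
     (indicator (path_image \<gamma>2) z' * indicator (path_image \<gamma>1) z * (z / z') ^ k
      - indicator (path_image \<gamma>1) z' * indicator (path_image \<gamma>2) z * (W a N m z' / W a N m z))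
     / (2 * of_real pi * \<i> * (z - z'))"

end

theory Submission
  imports Defs
begin

text \<open>
The operator \<open>M\<close> exchanges the two contours. Let \<open>A\<close> be its block with kernel
\<open>(v / u) ^ k / (2 \<pi> i (v - u))\<close>, \<open>v \<in> \<Sigma>\<^sub>1\<close>, \<open>u \<in> \<Sigma>\<^sub>2\<close>, and \<open>B\<close> the block with kernel
\<open>- W v / (2 \<pi> i W u (u - v))\<close>. Formally \<open>det (1 - M) = det (1 - A B)\<close>. Expand
\<open>1 / (u - v) = \<Sum>\<^sub>j v ^ j / u ^ (j + 1) + (v / u) ^ J / (u - v)\<close> with \<open>j < J = m + 1 - k\<close>. The remainder is
annihilated by \<open>A\<close>: the \<open>u\<close>-integral has all its poles inside \<open>\<Sigma>\<^sub>2\<close>, and its integrand is of order \<open>u\<^sup>-\<^sup>2\<close> at infinity because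
\<open>1 / W\<close> has degree \<open>m + 1\<close> there. So \<open>A B\<close> factors through a space of dimension \<open>J\<close>,
and reversing the two factors gives the \<open>J \<times> J\<close> matrix of the double contour integrals
\<open>K n' n\<close>, \<open>k \<le> n, n' \<le> m\<close>. On the other side, the same degree count shows that the rows of \<open>K\<close> with
\<open>n > m\<close> vanish. Hence the determinant on \<open>\<ell>\<^sup>2\<close> is that of the same finite matrix, up to transposition.

The determinants are defined by their series, and the manipulations with operators are justified
by traces. Fredholm's recursion for bordered minors yields Newton's identities
(\<open>fredholm_coeff_Newton\<close>): the terms of a Fredholm series are determined by the traces of the powers of
the kernel. So it suffices to compare traces: those of the even powers of \<open>M\<close> are twice those of the powers of
\<open>A B\<close>, those of the odd powers vanish (\<open>kpow_off_diagonal\<close>), and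
\<open>tr ((X Y) ^ r) = tr ((Y X) ^ r)\<close> leads to the finite matrix (\<open>fredholm_coeff_off_diagonal\<close>). The term of order \<open>2 r\<close> on
the side of the contours is the term of order \<open>r\<close> on the side of \<open>\<ell>\<^sup>2\<close>, and both series are finite.

All this takes place over a finite measure space with bounded measurable kernels. The contours have
to be brought into this form first. They may fail to be rectifiable, but all functions to be integrated
are holomorphic near them, one variable at a time; so the contours can be replaced by polynomial loops
nearby (\<open>polynomial_loop_homologous\<close>), successively in all the variables of the iterated integrals
(\<open>contours_power_holomorphic\<close>).
\<close>

section \<open>Bounded measurable functions\<close>

text \<open>Boundedness on the space (rather than essential boundedness) is what makes sections and diagonals of
kernels again bounded and measurable; over a finite measure it gives every integrability statement
and every use of Fubini's theorem below.\<close>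

definition bdd_meas :: "'a measure \<Rightarrow> ('a \<Rightarrow> complex) \<Rightarrow> bool" where
  "bdd_meas N f \<longleftrightarrow> f \<in> borel_measurable N \<and> (\<exists>C. \<forall>x \<in> space N. norm (f x) \<le> C)"

lemma bdd_measI:
  assumes "f \<in> borel_measurable N" "\<And>x. x \<in> space N \<Longrightarrow> norm (f x) \<le> C"
  shows "bdd_meas N f"
  using assms unfolding bdd_meas_def by blast

lemma bdd_meas_const [simp, intro]: "bdd_meas N (\<lambda>_. c)"
  unfolding bdd_meas_def by auto

lemma bdd_meas_add [intro]:
  assumes "bdd_meas N f" "bdd_meas N g"
  shows "bdd_meas N (\<lambda>x. f x + g x)"
proof -
  obtain C D where C: "\<forall>x \<in> space N. norm (f x) \<le> C" and D: "\<forall>x \<in> space N. norm (g x) \<le> D"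
    using assms unfolding bdd_meas_def by blast
  show ?thesis
    by (rule bdd_measI[where C = "C + D"])
      (use assms C D in \<open>auto simp: bdd_meas_def intro!: norm_triangle_mono\<close>)
qed

lemma bdd_meas_mult [intro]:
  assumes "bdd_meas N f" "bdd_meas N g"
  shows "bdd_meas N (\<lambda>x. f x * g x)"
proof -
  obtain C D where C: "\<forall>x \<in> space N. norm (f x) \<le> C" and D: "\<forall>x \<in> space N. norm (g x) \<le> D"
    using assms unfolding bdd_meas_def by blast
  have "norm (f x * g x) \<le> C * D" if "x \<in> space N" for x
    unfolding norm_mult
    using mult_mono[OF C[rule_format, OF that] D[rule_format, OF that]]
      order_trans[OF norm_ge_zero C[rule_format, OF that]] by simp
  then show ?thesis
    by (intro bdd_measI[where C = "C * D"]) (use assms in \<open>auto simp: bdd_meas_def\<close>)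
qed

lemma bdd_meas_sum [intro]:
  assumes "\<And>i. i \<in> I \<Longrightarrow> bdd_meas N (f i)"
  shows "bdd_meas N (\<lambda>x. \<Sum>i\<in>I. f i x)"
  using assms by (induction I rule: infinite_finite_induct) auto

lemma bdd_meas_prod [intro]:
  assumes "\<And>i. i \<in> I \<Longrightarrow> bdd_meas N (f i)"
  shows "bdd_meas N (\<lambda>x. \<Prod>i\<in>I. f i x)"
  using assms by (induction I rule: infinite_finite_induct) auto

lemma bdd_meas_cong:
  assumes "\<And>x. x \<in> space N \<Longrightarrow> f x = g x"
  shows "bdd_meas N f \<longleftrightarrow> bdd_meas N g"
  unfolding bdd_meas_def using assms by (simp cong: measurable_cong)

lemma bdd_meas_compose:
  assumes "bdd_meas M f" "h \<in> measurable N M"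
  shows "bdd_meas N (\<lambda>x. f (h x))"
proof -
  obtain C where C: "\<forall>x \<in> space M. norm (f x) \<le> C"
    using assms unfolding bdd_meas_def by blast
  show ?thesis
  proof (rule bdd_measI[where C = C])
    show "(\<lambda>x. f (h x)) \<in> borel_measurable N"
      using assms measurable_compose unfolding bdd_meas_def by blast
    show "norm (f (h x)) \<le> C" if "x \<in> space N" for x
      using C measurable_space[OF assms(2) that] by blast
  qed
qed

lemma bdd_meas_integrable:
  assumes "finite_measure N" "bdd_meas N f"
  shows "integrable N f"
proof -
  obtain C where C: "\<forall>x \<in> space N. norm (f x) \<le> C"
    using assms unfolding bdd_meas_def by blast
  show ?thesis
    by (rule finite_measure.integrable_const_bound[OF assms(1), where B = C])
      (use C assms in \<open>auto simp: bdd_meas_def\<close>)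
qed

lemma bdd_meas_integral:
  assumes N2: "finite_measure N2" and f: "bdd_meas (N1 \<Otimes>\<^sub>M N2) (\<lambda>(x, y). f x y)"
  shows "bdd_meas N1 (\<lambda>x. \<integral>y. f x y \<partial>N2)"
proof -
  interpret finite_measure N2 by fact
  obtain C where C: "\<And>x y. x \<in> space N1 \<Longrightarrow> y \<in> space N2 \<Longrightarrow> norm (f x y) \<le> C"
    using f unfolding bdd_meas_def by (auto simp: space_pair_measure)
  have [measurable]: "(\<lambda>(x, y). f x y) \<in> borel_measurable (N1 \<Otimes>\<^sub>M N2)"
    using f by (simp add: bdd_meas_def)
  show ?thesis
  proof (rule bdd_measI[where C = "C * measure N2 (space N2)"])
    show "(\<lambda>x. \<integral>y. f x y \<partial>N2) \<in> borel_measurable N1" by measurable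
    fix x assume x: "x \<in> space N1"
    have i: "integrable N2 (f x)"
      by (rule bdd_meas_integrable[OF N2], rule bdd_measI[where C = C])
        (use C x in \<open>auto simp: measurable_Pair_compose_split\<close>)
    have "norm (\<integral>y. f x y \<partial>N2) \<le> (\<integral>y. norm (f x y) \<partial>N2)" by (rule integral_norm_bound)
    also have "\<dots> \<le> (\<integral>y. C \<partial>N2)"
      by (rule integral_mono) (use i C x in auto)
    also have "\<dots> = C * measure N2 (space N2)" by simp
    finally show "norm (\<integral>y. f x y \<partial>N2) \<le> C * measure N2 (space N2)" .
  qed
qed

lemma bdd_meas_Fubini:
  assumes "finite_measure N1" "finite_measure N2" "bdd_meas (N1 \<Otimes>\<^sub>M N2) (\<lambda>(x, y). f x y)"
  shows "(\<integral>x. (\<integral>y. f x y \<partial>N2) \<partial>N1) = (\<integral>y. (\<integral>x. f x y \<partial>N1) \<partial>N2)"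
proof -
  interpret A: finite_measure N1 by fact
  interpret B: finite_measure N2 by fact
  interpret pair_sigma_finite N1 N2 ..
  have "finite_measure (N1 \<Otimes>\<^sub>M N2)"
    using assms(1,2) by (simp add: finite_measure_pair_measure)
  from Fubini_integral[OF bdd_meas_integrable[OF this assms(3)]] show ?thesis by simp
qed

lemma finite_measure_PiM:
  assumes "finite_measure N" "finite I"
  shows "finite_measure (PiM I (\<lambda>_. N))"
proof -
  interpret finite_measure N by fact
  interpret product_sigma_finite "\<lambda>_. N" ..
  show ?thesis
    by standard (simp add: space_PiM emeasure_PiM assms(2) ennreal_prod_eq_top power_eq_top_ennreal emeasure_finite)
qed

lemma PiM_insert_integral:
  assumes N: "finite_measure N" and I: "finite I" "i \<notin> I"
    and f: "bdd_meas (PiM (insert i I) (\<lambda>_. N)) f"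
  shows "(\<integral>z. f z \<partial>PiM (insert i I) (\<lambda>_. N)) = (\<integral>x. (\<integral>z. f (z(i := x)) \<partial>PiM I (\<lambda>_. N)) \<partial>N)"
proof -
  interpret finite_measure N by fact
  interpret product_sigma_finite "\<lambda>_. N" ..
  have "integrable (PiM (insert i I) (\<lambda>_. N)) f"
    by (intro bdd_meas_integrable finite_measure_PiM) (use N I f in auto)
  from product_integral_insert[OF I this]
  have "(\<integral>z. f z \<partial>PiM (insert i I) (\<lambda>_. N)) = (\<integral>z. (\<integral>x. f (z(i := x)) \<partial>N) \<partial>PiM I (\<lambda>_. N))" .
  also have "\<dots> = (\<integral>x. (\<integral>z. f (z(i := x)) \<partial>PiM I (\<lambda>_. N)) \<partial>N)"
  proof (rule bdd_meas_Fubini)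
    show "finite_measure (PiM I (\<lambda>_. N))" using N I by (simp add: finite_measure_PiM)
    show "bdd_meas (PiM I (\<lambda>_. N) \<Otimes>\<^sub>M N) (\<lambda>(z, x). f (z(i := x)))"
      using bdd_meas_compose[OF f measurable_add_dim] by (simp add: case_prod_unfold)
  qed fact
  finally show ?thesis .
qed

text \<open>Relabelling the integration variables makes the terms in Fredholm's recursion for bordered minors equal.
The product measure is determined by its values on rectangles, and these are permuted.\<close>

lemma PiM_permute:
  assumes N: "finite_measure N" and I: "finite I" and \<tau>: "\<tau> permutes I"
    and f: "f \<in> borel_measurable (PiM I (\<lambda>_. N))"
  shows "(\<integral>z. f (\<lambda>i\<in>I. z (\<tau> i)) \<partial>PiM I (\<lambda>_. N)) = ((\<integral>z. f z \<partial>PiM I (\<lambda>_. N)) :: complex)"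
proof -
  interpret finite_measure N by fact
  interpret product_sigma_finite "\<lambda>_. N" ..
  let ?P = "PiM I (\<lambda>_. N)"
  let ?h = "\<lambda>z. \<lambda>i\<in>I. z (\<tau> i)"
  have \<tau>I: "\<tau> i \<in> I" if "i \<in> I" for i using \<tau> that by (simp add: permutes_in_image)
  have h: "?h \<in> measurable ?P ?P"
    by (rule measurable_restrict) (auto intro: measurable_component_singleton \<tau>I)
  have "distr ?P ?P ?h = ?P"
  proof (rule PiM_eqI[OF I])
    fix A assume A: "\<And>i. i \<in> I \<Longrightarrow> A i \<in> sets N"
    have inv: "Hilbert_Choice.inv \<tau> i \<in> I" if "i \<in> I" for i
      using permutes_inv[OF \<tau>] that by (simp add: permutes_in_image)
    have "?h -` (PiE I A) \<inter> space ?P = PiE I (\<lambda>i. A (Hilbert_Choice.inv \<tau> i))"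
    proof (intro subset_antisym subsetI)
      fix z assume "z \<in> ?h -` (PiE I A) \<inter> space ?P"
      then have z: "\<And>i. i \<in> I \<Longrightarrow> z (\<tau> i) \<in> A i" "z \<in> extensional I"
        by (auto simp: space_PiM PiE_def Pi_iff)
      have "z i \<in> A (Hilbert_Choice.inv \<tau> i)" if "i \<in> I" for i
        using z(1)[OF inv[OF that]] permutes_inverses(1)[OF \<tau>] by metis
      then show "z \<in> PiE I (\<lambda>i. A (Hilbert_Choice.inv \<tau> i))" using z(2) by (auto simp: PiE_def)
    next
      fix z assume z: "z \<in> PiE I (\<lambda>i. A (Hilbert_Choice.inv \<tau> i))"
      have "z (\<tau> i) \<in> A i" if "i \<in> I" for i
        using PiE_mem[OF z \<tau>I[OF that]] permutes_inverses(2)[OF \<tau>] by metis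
      moreover have "z i \<in> space N" if "i \<in> I" for i
        using PiE_mem[OF z that] A[OF inv[OF that]] sets.sets_into_space by blast
      ultimately show "z \<in> ?h -` (PiE I A) \<inter> space ?P"
        using z by (auto simp: space_PiM PiE_def)
    qed
    moreover have "PiE I A \<in> sets ?P" using A I by (intro sets_PiM_I_finite) auto
    ultimately have "emeasure (distr ?P ?P ?h) (PiE I A) = emeasure ?P (PiE I (\<lambda>i. A (Hilbert_Choice.inv \<tau> i)))"
      using emeasure_distr[OF h] by simp
    also have "\<dots> = (\<Prod>i\<in>I. emeasure N (A (Hilbert_Choice.inv \<tau> i)))"
      using A inv by (intro emeasure_PiM[OF I]) auto
    also have "\<dots> = (\<Prod>i\<in>I. emeasure N (A i))"
      using prod.permute[OF permutes_inv[OF \<tau>], of "\<lambda>i. emeasure N (A i)"] by (simp add: o_def)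
    finally show "emeasure (distr ?P ?P ?h) (PiE I A) = (\<Prod>i\<in>I. emeasure N (A i))" .
  qed simp
  then show ?thesis using integral_distr[OF h f] by simp
qed

section \<open>Composition and traces of kernels\<close>

definition kcomp ::
    "'b measure \<Rightarrow> ('a \<Rightarrow> 'b \<Rightarrow> complex) \<Rightarrow> ('b \<Rightarrow> 'c \<Rightarrow> complex) \<Rightarrow> 'a \<Rightarrow> 'c \<Rightarrow> complex" where
  "kcomp N X Y x z = (\<integral>y. X x y * Y y z \<partial>N)"

definition ktrace :: "'a measure \<Rightarrow> ('a \<Rightarrow> 'a \<Rightarrow> complex) \<Rightarrow> complex" where
  "ktrace N X = (\<integral>x. X x x \<partial>N)"

text \<open>The exponent is shifted by one, since integral kernels have no unit: \<open>kpow N X r\<close> is the kernel of the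
power \<open>X ^ (r + 1)\<close>.\<close>

primrec kpow :: "'a measure \<Rightarrow> ('a \<Rightarrow> 'a \<Rightarrow> complex) \<Rightarrow> nat \<Rightarrow> 'a \<Rightarrow> 'a \<Rightarrow> complex" where
  "kpow N X 0 = X"
| "kpow N X (Suc r) = kcomp N X (kpow N X r)"

abbreviation bdd_kernel :: "'a measure \<Rightarrow> 'b measure \<Rightarrow> ('a \<Rightarrow> 'b \<Rightarrow> complex) \<Rightarrow> bool" where
  "bdd_kernel N1 N2 X \<equiv> bdd_meas (N1 \<Otimes>\<^sub>M N2) (\<lambda>(x, y). X x y)"

lemma bdd_kernel_compose:
  assumes "bdd_kernel N1 N2 X" "f \<in> measurable M N1" "g \<in> measurable M N2"
  shows "bdd_meas M (\<lambda>z. X (f z) (g z))"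
  using bdd_meas_compose[OF assms(1), of "\<lambda>z. (f z, g z)" M] assms(2,3) by simp

lemma bdd_kernel_row: "bdd_kernel N1 N2 X \<Longrightarrow> x \<in> space N1 \<Longrightarrow> bdd_meas N2 (X x)"
  using bdd_kernel_compose[of N1 N2 X "\<lambda>_. x" N2 "\<lambda>y. y"] by simp

lemma bdd_kernel_col: "bdd_kernel N1 N2 X \<Longrightarrow> y \<in> space N2 \<Longrightarrow> bdd_meas N1 (\<lambda>x. X x y)"
  using bdd_kernel_compose[of N1 N2 X "\<lambda>x. x" N1 "\<lambda>_. y"] by simp

lemma bdd_kernel_kcomp:
  assumes "finite_measure N2" "bdd_kernel N1 N2 X" "bdd_kernel N2 N3 Y"
  shows "bdd_kernel N1 N3 (kcomp N2 X Y)"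
proof -
  have "bdd_meas ((N1 \<Otimes>\<^sub>M N3) \<Otimes>\<^sub>M N2) (\<lambda>(w, y). X (fst w) y * Y y (snd w))"
    unfolding case_prod_unfold
    by (rule bdd_meas_mult; rule bdd_kernel_compose[OF assms(2)] bdd_kernel_compose[OF assms(3)]; measurable)
  from bdd_meas_integral[OF assms(1) this]
  show ?thesis unfolding kcomp_def case_prod_unfold .
qed

lemma bdd_kernel_kpow:
  assumes "finite_measure N" "bdd_kernel N N X"
  shows "bdd_kernel N N (kpow N X r)"
proof (induction r)
  case (Suc r)
  show ?case using bdd_kernel_kcomp[OF assms Suc] by simp
qed (simp add: assms)

lemma kcomp_assoc:
  assumes N: "finite_measure N2" "finite_measure N3"
    and X: "bdd_kernel N1 N2 X" and Y: "bdd_kernel N2 N3 Y" and Z: "bdd_kernel N3 N4 Z"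
    and x: "x \<in> space N1" and w: "w \<in> space N4"
  shows "kcomp N3 (kcomp N2 X Y) Z x w = kcomp N2 X (kcomp N3 Y Z) x w"
proof -
  have b: "bdd_meas (N3 \<Otimes>\<^sub>M N2) (\<lambda>(z, y). X x y * Y y z * Z z w)"
    unfolding case_prod_unfold
    by (intro bdd_meas_mult bdd_kernel_compose[OF X] bdd_kernel_compose[OF Y] bdd_kernel_compose[OF Z])
      (use x w in measurable)
  have "kcomp N3 (kcomp N2 X Y) Z x w = (\<integral>z. (\<integral>y. X x y * Y y z * Z z w \<partial>N2) \<partial>N3)"
    by (simp add: kcomp_def)
  also have "\<dots> = (\<integral>y. (\<integral>z. X x y * Y y z * Z z w \<partial>N3) \<partial>N2)"
    by (rule bdd_meas_Fubini[OF N(2,1) b])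
  also have "\<dots> = kcomp N2 X (kcomp N3 Y Z) x w"
    by (simp add: kcomp_def mult.assoc)
  finally show ?thesis .
qed

lemma ktrace_commute:
  assumes N: "finite_measure N1" "finite_measure N2"
    and X: "bdd_kernel N1 N2 X" and Y: "bdd_kernel N2 N1 Y"
  shows "ktrace N1 (kcomp N2 X Y) = ktrace N2 (kcomp N1 Y X)"
proof -
  have "bdd_meas (N1 \<Otimes>\<^sub>M N2) (\<lambda>(x, y). X x y * Y y x)"
    unfolding case_prod_unfold
    by (intro bdd_meas_mult bdd_kernel_compose[OF X] bdd_kernel_compose[OF Y]) measurable
  from bdd_meas_Fubini[OF N this] show ?thesis
    by (simp add: ktrace_def kcomp_def mult.commute)
qed

lemma kcomp_cong:
  assumes "\<And>y. y \<in> space N \<Longrightarrow> X x y = X' x y" "\<And>y. y \<in> space N \<Longrightarrow> Y y z = Y' y z"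
  shows "kcomp N X Y x z = kcomp N X' Y' x z"
  unfolding kcomp_def by (rule Bochner_Integration.integral_cong) (use assms in auto)

lemma kcomp_cong_right:
  assumes "\<And>y. y \<in> space N \<Longrightarrow> Y y z = Y' y z"
  shows "kcomp N X Y x z = kcomp N X Y' x z"
  by (rule kcomp_cong) (use assms in auto)

lemma ktrace_cong:
  assumes "\<And>x. x \<in> space N \<Longrightarrow> X x x = X' x x"
  shows "ktrace N X = ktrace N X'"
  unfolding ktrace_def by (rule Bochner_Integration.integral_cong) (use assms in auto)

lemma kpow_cong:
  assumes "\<And>x y. x \<in> space N \<Longrightarrow> y \<in> space N \<Longrightarrow> X x y = X' x y"
  shows "x \<in> space N \<Longrightarrow> y \<in> space N \<Longrightarrow> kpow N X r x y = kpow N X' r x y"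
proof (induction r arbitrary: x)
  case (Suc r)
  then show ?case unfolding kpow.simps by (intro kcomp_cong) (auto intro: assms)
qed (simp add: assms)

text \<open>With the shifted exponents, this is \<open>(X Y) ^ (r + 2) = X (Y X) ^ (r + 1) Y\<close> for operators \<open>X\<close>, \<open>Y\<close> between two
different spaces.\<close>

lemma kpow_kcomp:
  assumes N: "finite_measure N1" "finite_measure N2"
    and X: "bdd_kernel N1 N2 X" and Y: "bdd_kernel N2 N1 Y"
    and x: "x \<in> space N1" and z: "z \<in> space N1"
  shows "kpow N1 (kcomp N2 X Y) (Suc r) x z = kcomp N2 X (kcomp N2 (kpow N2 (kcomp N1 Y X) r) Y) x z"
  using x z
proof (induction r arbitrary: x z)
  case 0
  have XY: "bdd_kernel N1 N1 (kcomp N2 X Y)" by (intro bdd_kernel_kcomp N X Y)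
  have "kcomp N1 (kcomp N2 X Y) (kcomp N2 X Y) x z = kcomp N2 X (kcomp N1 Y (kcomp N2 X Y)) x z"
    by (rule kcomp_assoc[OF N(2,1) X Y XY]) fact+
  also have "\<dots> = kcomp N2 X (kcomp N2 (kcomp N1 Y X) Y) x z"
    by (rule kcomp_cong_right, rule kcomp_assoc[OF N(1,2) Y X Y, symmetric]) (use 0 in auto)
  finally show ?case by simp
next
  case (Suc r)
  let ?P = "kpow N2 (kcomp N1 Y X) r"
  have XY: "bdd_kernel N1 N1 (kcomp N2 X Y)" and YX: "bdd_kernel N2 N2 (kcomp N1 Y X)"
    by (intro bdd_kernel_kcomp N X Y)+
  have P: "bdd_kernel N2 N2 ?P" by (intro bdd_kernel_kpow N YX)
  have PY: "bdd_kernel N2 N1 (kcomp N2 ?P Y)" by (intro bdd_kernel_kcomp N P Y)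
  have XPY: "bdd_kernel N1 N1 (kcomp N2 X (kcomp N2 ?P Y))" by (intro bdd_kernel_kcomp N X PY)
  have "kpow N1 (kcomp N2 X Y) (Suc (Suc r)) x z
      = kcomp N1 (kcomp N2 X Y) (kcomp N2 X (kcomp N2 ?P Y)) x z"
    unfolding kpow.simps(2)[of _ _ "Suc r"] by (rule kcomp_cong_right, rule Suc.IH) (use Suc.prems in auto)
  also have "\<dots> = kcomp N2 X (kcomp N1 Y (kcomp N2 X (kcomp N2 ?P Y))) x z"
    by (rule kcomp_assoc[OF N(2,1) X Y XPY]) fact+
  also have "\<dots> = kcomp N2 X (kcomp N2 (kcomp N1 Y X) (kcomp N2 ?P Y)) x z"
    by (rule kcomp_cong_right, rule kcomp_assoc[OF N(1,2) Y X PY, symmetric]) (use Suc.prems in auto)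
  also have "\<dots> = kcomp N2 X (kcomp N2 (kcomp N2 (kcomp N1 Y X) ?P) Y) x z"
    by (rule kcomp_cong_right, rule kcomp_assoc[OF N(2,2) YX P Y, symmetric]) (use Suc.prems in auto)
  finally show ?case by simp
qed

text \<open>The form of the identity of \<open>det (1 - X Y)\<close> and \<open>det (1 - Y X)\<close> that is needed here: it moves the traces of
powers from one space to another, in particular from contours to a finite index set.\<close>

lemma ktrace_kpow_commute:
  assumes N: "finite_measure N1" "finite_measure N2"
    and X: "bdd_kernel N1 N2 X" and Y: "bdd_kernel N2 N1 Y"
  shows "ktrace N1 (kpow N1 (kcomp N2 X Y) r) = ktrace N2 (kpow N2 (kcomp N1 Y X) r)"
proof (cases r)
  case 0
  then show ?thesis using ktrace_commute[OF N X Y] by simp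
next
  case (Suc q)
  let ?P = "kpow N2 (kcomp N1 Y X) q"
  have YX: "bdd_kernel N2 N2 (kcomp N1 Y X)" by (intro bdd_kernel_kcomp N X Y)
  have P: "bdd_kernel N2 N2 ?P" by (intro bdd_kernel_kpow N YX)
  have PY: "bdd_kernel N2 N1 (kcomp N2 ?P Y)" by (intro bdd_kernel_kcomp N P Y)
  have "ktrace N1 (kpow N1 (kcomp N2 X Y) (Suc q)) = ktrace N1 (kcomp N2 X (kcomp N2 ?P Y))"
    by (rule ktrace_cong, rule kpow_kcomp[OF N X Y])
  also have "\<dots> = ktrace N2 (kcomp N1 (kcomp N2 ?P Y) X)"
    by (rule ktrace_commute[OF N X PY])
  also have "\<dots> = ktrace N2 (kcomp N2 ?P (kcomp N1 Y X))"
    by (rule ktrace_cong, rule kcomp_assoc[OF N(2,1) P Y X])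
  also have "\<dots> = ktrace N2 (kcomp N2 (kcomp N1 Y X) ?P)"
    by (rule ktrace_commute[OF N(2,2) P YX])
  finally show ?thesis by (simp add: Suc)
qed

section \<open>Newton's identities for Fredholm series\<close>

text \<open>Minors with independent rows and columns are needed because bordering a principal minor by a point
\<open>x\<close> as row and a point \<open>y\<close> as column leads out of the principal minors.\<close>

definition kminor :: "('a \<Rightarrow> 'b \<Rightarrow> complex) \<Rightarrow> nat \<Rightarrow> (nat \<Rightarrow> 'a) \<Rightarrow> (nat \<Rightarrow> 'b) \<Rightarrow> complex" where
  "kminor X p u v = Determinant.det (Matrix.mat p p (\<lambda>(i, j). X (u i) (v j)))"

lemma kernel_minor_eq_kminor: "kernel_minor X p z = kminor X p z z"
  by (simp add: kernel_minor_def kminor_def)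

lemma kminor_leibniz:
  "kminor X p u v = (\<Sum>\<sigma>\<in>{\<sigma>. \<sigma> permutes {0..<p}}. signof \<sigma> * (\<Prod>i = 0..<p. X (u i) (v (\<sigma> i))))"
proof -
  have "\<sigma> i < p" if "\<sigma> permutes {0..<p}" "i < p" for \<sigma> i
    using permutes_in_image[OF that(1), of i] that(2) by simp
  then show ?thesis unfolding kminor_def
    by (subst det_def'[where n = p]) (auto intro!: sum.cong prod.cong arg_cong2[where f = "(*)"])
qed

lemma kminor_cong:
  assumes "\<And>i j. i < p \<Longrightarrow> j < p \<Longrightarrow> X (u i) (v j) = X' (u' i) (v' j)"
  shows "kminor X p u v = kminor X' p u' v'"
  unfolding kminor_def by (intro arg_cong[where f = Determinant.det] eq_matI) (auto simp: assms)

lemma bdd_meas_kminor: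
  assumes X: "bdd_kernel N1 N2 X"
    and "\<And>i. i < p \<Longrightarrow> (\<lambda>w. u w i) \<in> measurable M N1" "\<And>i. i < p \<Longrightarrow> (\<lambda>w. v w i) \<in> measurable M N2"
  shows "bdd_meas M (\<lambda>w. kminor X p (u w) (v w))"
proof -
  have "\<sigma> i < p" if "\<sigma> permutes {0..<p}" "i < p" for \<sigma> i
    using permutes_in_image[OF that(1), of i] that(2) by simp
  then show ?thesis unfolding kminor_leibniz
    by (intro bdd_meas_sum bdd_meas_mult bdd_meas_const bdd_meas_prod bdd_kernel_compose[OF X] assms) auto
qed

text \<open>The two signs produced by permuting rows and columns in the same way cancel.\<close>

lemma det_conjugate_permutation:
  fixes f :: "nat \<Rightarrow> nat \<Rightarrow> 'a :: comm_ring_1"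
  assumes \<tau>: "\<tau> permutes {0..<n}"
  shows "Determinant.det (Matrix.mat n n (\<lambda>(i, j). f (\<tau> i) (\<tau> j)))
       = Determinant.det (Matrix.mat n n (\<lambda>(i, j). f i j))"
proof -
  have \<tau>n: "\<tau> i < n" if "i < n" for i using permutes_in_image[OF \<tau>, of i] that by simp
  define A where "A = Matrix.mat n n (\<lambda>(i, j). f i j)"
  define B where "B = Matrix.mat n n (\<lambda>(i, j). A $$ (\<tau> i, j))"
  have A: "A \<in> carrier_mat n n" and B: "B \<in> carrier_mat n n" by (simp_all add: A_def B_def)
  have "Matrix.mat n n (\<lambda>(i, j). f (\<tau> i) (\<tau> j))
      = transpose_mat (Matrix.mat n n (\<lambda>(i, j). transpose_mat B $$ (\<tau> i, j)))"
    by (rule eq_matI) (auto simp: A_def B_def \<tau>n)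
  also have "Determinant.det \<dots> = Determinant.det (Matrix.mat n n (\<lambda>(i, j). transpose_mat B $$ (\<tau> i, j)))"
    by (rule det_transpose[where n = n]) auto
  also have "\<dots> = signof \<tau> * Determinant.det (transpose_mat B)"
    by (rule det_permute_rows[OF _ \<tau>]) (use B in auto)
  also have "\<dots> = signof \<tau> * (signof \<tau> * Determinant.det A)"
    using det_transpose[OF B] det_permute_rows[OF A \<tau>] by (simp add: B_def)
  also have "\<dots> = Determinant.det A"
    by (simp add: sign_def)
  finally show ?thesis by (simp add: A_def)
qed

text \<open>The cofactors of the bordered matrix along its last row, written as a determinant of full size: the last
row is replaced by a unit vector. In this form the points keep their indices, so that a
simultaneous permutation of rows and columns acts on all cofactors at once.\<close>

definition last_row_cofactor ::
    "('a \<Rightarrow> 'b \<Rightarrow> complex) \<Rightarrow> nat \<Rightarrow> 'b \<Rightarrow> nat \<Rightarrow> (nat \<Rightarrow> 'a) \<Rightarrow> (nat \<Rightarrow> 'b) \<Rightarrow> complex" where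
  "last_row_cofactor X p y j u v = Determinant.det (Matrix.mat (Suc p) (Suc p)
     (\<lambda>(i, c). if i = p then (if c = j then 1 else 0) else X (u i) (if c = p then y else v c)))"

lemma last_row_cofactor_eq_cofactor:
  assumes "j \<le> p"
  shows "last_row_cofactor X p y j u v
    = cofactor (Matrix.mat (Suc p) (Suc p) (\<lambda>(i, c). X ((u(p := x)) i) ((v(p := y)) c))) p j"
proof -
  let ?A = "Matrix.mat (Suc p) (Suc p)
     (\<lambda>(i, c). if i = p then (if c = j then 1 else 0) else X (u i) (if c = p then y else v c))"
  have "last_row_cofactor X p y j u v = (\<Sum>c<Suc p. ?A $$ (p, c) * cofactor ?A p c)"
    unfolding last_row_cofactor_def by (rule laplace_expansion_row) auto
  also have "\<dots> = (\<Sum>c<Suc p. if c = j then cofactor ?A p c else 0)"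
    by (rule sum.cong) auto
  also have "\<dots> = cofactor ?A p j" using assms by simp
  also have "\<dots> = cofactor (Matrix.mat (Suc p) (Suc p) (\<lambda>(i, c). X ((u(p := x)) i) ((v(p := y)) c))) p j"
    unfolding cofactor_def mat_delete_def using assms
    by (intro arg_cong2[where f = "(*)"] refl arg_cong[where f = Determinant.det] eq_matI)
      (auto split: if_splits)
  finally show ?thesis .
qed

lemma bordered_minor_expand:
  "kminor X (Suc p) (u(p := x)) (v(p := y))
     = X x y * kminor X p u v + (\<Sum>j<p. X x (v j) * last_row_cofactor X p y j u v)"
proof -
  let ?A = "Matrix.mat (Suc p) (Suc p) (\<lambda>(i, c). X ((u(p := x)) i) ((v(p := y)) c))"
  have "kminor X (Suc p) (u(p := x)) (v(p := y)) = (\<Sum>j<Suc p. ?A $$ (p, j) * cofactor ?A p j)"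
    unfolding kminor_def by (rule laplace_expansion_row) auto
  also have "\<dots> = (\<Sum>j<p. ?A $$ (p, j) * cofactor ?A p j) + ?A $$ (p, p) * cofactor ?A p p"
    by simp
  also have "(\<Sum>j<p. ?A $$ (p, j) * cofactor ?A p j)
      = (\<Sum>j<p. X x (v j) * last_row_cofactor X p y j u v)"
    by (rule sum.cong) (auto simp: last_row_cofactor_eq_cofactor[where x = x])
  also have "cofactor ?A p p = kminor X p u v"
    unfolding cofactor_def mat_delete_def kminor_def
    by (auto intro!: arg_cong[where f = Determinant.det] eq_matI)
  also have "?A $$ (p, p) = X x y" by simp
  finally show ?thesis by (simp only: add.commute)
qed

text \<open>The cofactor in the last but one column is, up to sign, again a bordered minor, of size smaller by
one: the deleted column leaves the last point \<open>u p\<close> as the bordering row. This is what makes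
Fredholm's recursion close up.\<close>

lemma last_row_cofactor_last:
  "last_row_cofactor X (Suc p) y p u v = - kminor X (Suc p) u (v(p := y))"
proof -
  have "last_row_cofactor X (Suc p) y p u v
      = cofactor (Matrix.mat (Suc (Suc p)) (Suc (Suc p))
          (\<lambda>(i, c). X ((u(Suc p := undefined)) i) ((v(Suc p := y)) c))) (Suc p) p"
    by (rule last_row_cofactor_eq_cofactor) simp
  also have "\<dots> = - kminor X (Suc p) u (v(p := y))"
    unfolding cofactor_def mat_delete_def kminor_def
    by (auto intro!: arg_cong[where f = Determinant.det] eq_matI simp: power_add less_Suc_eq)
  finally show ?thesis .
qed

lemma last_row_cofactor_permute:
  assumes \<tau>: "\<tau> permutes {..<p}" and j: "j < p"
    and u: "\<And>i. i < p \<Longrightarrow> u' i = u (\<tau> i)" and v: "\<And>i. i < p \<Longrightarrow> v' i = v (\<tau> i)"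
  shows "last_row_cofactor X p y j u' v' = last_row_cofactor X p y (\<tau> j) u v"
proof -
  let ?f = "\<lambda>i c. if i = p then (if c = \<tau> j then 1 else 0) else X (u i) (if c = p then y else v c)"
  have \<tau>': "\<tau> permutes {0..<Suc p}" by (rule permutes_subset[OF \<tau>]) auto
  have p: "\<tau> p = p" using \<tau> by (simp add: permutes_def)
  have lt: "\<tau> i \<noteq> p" if "i < p" for i using permutes_in_image[OF \<tau>, of i] that by auto
  have "last_row_cofactor X p y j u' v'
      = Determinant.det (Matrix.mat (Suc p) (Suc p) (\<lambda>(i, c). ?f (\<tau> i) (\<tau> c)))"
    unfolding last_row_cofactor_def
    by (intro arg_cong[where f = Determinant.det] eq_matI)
      (use p lt j u v permutes_inj[OF \<tau>] in \<open>auto simp: less_Suc_eq inj_eq\<close>)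
  also have "\<dots> = last_row_cofactor X p y (\<tau> j) u v"
    unfolding last_row_cofactor_def by (rule det_conjugate_permutation[OF \<tau>'])
  finally show ?thesis .
qed

lemma bdd_meas_last_row_cofactor:
  assumes X: "bdd_kernel N1 N2 X" and y: "y \<in> space N2" and j: "j < p"
    and u: "\<And>i. i < p \<Longrightarrow> (\<lambda>w. u w i) \<in> measurable M N1"
    and v: "\<And>i. i < p \<Longrightarrow> (\<lambda>w. v w i) \<in> measurable M N2"
  shows "bdd_meas M (\<lambda>w. last_row_cofactor X p y j (u w) (v w))"
proof -
  have le: "\<sigma> i < Suc p" if "\<sigma> permutes {0..<Suc p}" "i < Suc p" for \<sigma> i
    using permutes_in_image[OF that(1), of i] that(2) by simp
  have entry: "bdd_meas M (\<lambda>w. if i = p then (if c = j then 1 else 0)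
      else X (u w i) (if c = p then y else v w c))" if "i < Suc p" "c < Suc p" for i c
  proof (cases "i = p")
    case False
    then show ?thesis using that
      by (cases "c = p") (auto intro!: bdd_kernel_compose[OF X] u v measurable_const[OF y] simp: less_Suc_eq)
  qed simp
  have "last_row_cofactor X p y j (u w) (v w) = (\<Sum>\<sigma>\<in>{\<sigma>. \<sigma> permutes {0..<Suc p}}. signof \<sigma> *
      (\<Prod>i = 0..<Suc p. if i = p then (if \<sigma> i = j then 1 else 0)
      else X (u w i) (if \<sigma> i = p then y else v w (\<sigma> i))))" for w
    unfolding last_row_cofactor_def
    by (subst det_def'[where n = "Suc p"]) (auto intro!: sum.cong prod.cong arg_cong2[where f = "(*)"] simp del: prod.atLeast0_lessThan_Suc simp: le)
  then show ?thesis
    by (simp only:) (intro bdd_meas_sum bdd_meas_mult bdd_meas_const bdd_meas_prod entry; simp add: le)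
qed

definition minor_integral :: "'a measure \<Rightarrow> ('a \<Rightarrow> 'a \<Rightarrow> complex) \<Rightarrow> nat \<Rightarrow> complex" where
  "minor_integral N X p = (\<integral>z. kernel_minor X p z \<partial>PiM {..<p} (\<lambda>_. N))"

definition bordered_integral :: "'a measure \<Rightarrow> ('a \<Rightarrow> 'a \<Rightarrow> complex) \<Rightarrow> nat \<Rightarrow> 'a \<Rightarrow> 'a \<Rightarrow> complex" where
  "bordered_integral N X p x y =
     (\<integral>z. kminor X (Suc p) (z(p := x)) (z(p := y)) \<partial>PiM {..<p} (\<lambda>_. N))"

lemma measurable_upd_component:
  assumes "x \<in> measurable M N" "\<And>i. i < p \<Longrightarrow> (\<lambda>w. z w i) \<in> measurable M N" "i < Suc p"
  shows "(\<lambda>w. ((z w)(p := x w)) i) \<in> measurable M N"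
  using assms by (cases "i = p") (auto simp: less_Suc_eq)

lemma bdd_meas_kernel_minor_PiM:
  assumes "bdd_kernel N N X"
  shows "bdd_meas (PiM {..<p} (\<lambda>_. N)) (kernel_minor X p)"
  using bdd_meas_kminor[OF assms, of p "\<lambda>z. z" "PiM {..<p} (\<lambda>_. N)" "\<lambda>z. z"]
  by (simp add: kernel_minor_eq_kminor[abs_def])

lemma minor_integral_Suc:
  assumes N: "finite_measure N" and X: "bdd_kernel N N X"
  shows "minor_integral N X (Suc p) = (\<integral>x. bordered_integral N X p x x \<partial>N)"
proof -
  have "bdd_meas (PiM (insert p {..<p}) (\<lambda>_. N)) (kernel_minor X (Suc p))"
    using bdd_meas_kernel_minor_PiM[OF X, of "Suc p"] by (simp add: lessThan_Suc)
  from PiM_insert_integral[OF N _ _ this]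
  show ?thesis
    by (simp add: minor_integral_def bordered_integral_def lessThan_Suc kernel_minor_eq_kminor)
qed

lemma bordered_integral_0: "bordered_integral N X 0 x y = X x y"
  by (simp add: bordered_integral_def PiM_empty kminor_leibniz lebesgue_integral_count_space_finite)

text \<open>Expand the bordered minor along its last row. The entry \<open>X x y\<close> contributes the unbordered integral.
The remaining \<open>p + 1\<close> terms all have the same integral, because exchanging two of the integration
variables exchanges the corresponding cofactors; the last one is a composition of \<open>X\<close> with the
bordered integral of lower order.\<close>

lemma bordered_integral_Suc:
  assumes N: "finite_measure N" and X: "bdd_kernel N N X"
    and x: "x \<in> space N" and y: "y \<in> space N"
  shows "bordered_integral N X (Suc p) x y
    = X x y * minor_integral N X (Suc p) - of_nat (Suc p) * kcomp N X (bordered_integral N X p) x y"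
proof -
  let ?P = "\<lambda>p. PiM {..<p} (\<lambda>_. N)"
  let ?F = "\<lambda>j z. X x (z j) * last_row_cofactor X (Suc p) y j z z"
  have F: "bdd_meas (?P (Suc p)) (?F j)" if "j < Suc p" for j
    by (intro bdd_meas_mult bdd_kernel_compose[OF X] bdd_meas_last_row_cofactor[OF X])
      (use that x y in auto)
  have int: "finite_measure (?P q)" for q :: nat by (intro finite_measure_PiM N) simp
  have "bordered_integral N X (Suc p) x y
      = (\<integral>z. X x y * kernel_minor X (Suc p) z + (\<Sum>j<Suc p. ?F j z) \<partial>?P (Suc p))"
    unfolding bordered_integral_def bordered_minor_expand kernel_minor_eq_kminor ..
  also have "\<dots> = X x y * minor_integral N X (Suc p) + (\<Sum>j<Suc p. \<integral>z. ?F j z \<partial>?P (Suc p))"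
    unfolding minor_integral_def
    by (subst Bochner_Integration.integral_add)
      (auto intro!: bdd_meas_integrable[OF int] bdd_meas_mult bdd_meas_kernel_minor_PiM[OF X]
        Bochner_Integration.integral_sum bdd_meas_sum F simp del: sum.lessThan_Suc)
  also have "(\<Sum>j<Suc p. \<integral>z. ?F j z \<partial>?P (Suc p)) = (\<Sum>j<Suc p. \<integral>z. ?F p z \<partial>?P (Suc p))"
  proof (rule sum.cong[OF refl])
    fix j assume j: "j \<in> {..<Suc p}"
    let ?t = "Transposition.transpose j p"
    have t: "?t permutes {..<Suc p}" using j by (intro permutes_swap_id) auto
    have eq: "?F j z = ?F p (\<lambda>i\<in>{..<Suc p}. z (?t i))" for z
      using last_row_cofactor_permute[OF t, of p "\<lambda>i\<in>{..<Suc p}. z (?t i)" z "\<lambda>i\<in>{..<Suc p}. z (?t i)" z X y]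
      by simp
    show "(\<integral>z. ?F j z \<partial>?P (Suc p)) = (\<integral>z. ?F p z \<partial>?P (Suc p))"
      unfolding eq
      by (rule PiM_permute[OF N _ t]) (use F[of p] in \<open>auto simp: bdd_meas_def\<close>)
  qed
  also have "\<dots> = of_nat (Suc p) * (\<integral>z. ?F p z \<partial>?P (Suc p))" by simp
  also have "(\<integral>z. ?F p z \<partial>?P (Suc p)) = (\<integral>s. (\<integral>z. ?F p (z(p := s)) \<partial>?P p) \<partial>N)"
    using PiM_insert_integral[OF N, of "{..<p}" p "?F p"] F[of p] by (simp add: lessThan_Suc)
  also have "\<dots> = - kcomp N X (bordered_integral N X p) x y"
    by (simp add: last_row_cofactor_last kcomp_def bordered_integral_def)
  finally show ?thesis by simp
qed

text \<open>The \<open>p\<close>-th term of the Fredholm series of \<open>det (1 - X)\<close> over the measure space \<open>N\<close>.\<close>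

definition fredholm_coeff :: "'a measure \<Rightarrow> ('a \<Rightarrow> 'a \<Rightarrow> complex) \<Rightarrow> nat \<Rightarrow> complex" where
  "fredholm_coeff N X p = (-1) ^ p / fact p * minor_integral N X p"

lemma fredholm_coeff_0: "fredholm_coeff N X 0 = 1"
  by (simp add: fredholm_coeff_def minor_integral_def kernel_minor_eq_kminor PiM_empty
      kminor_leibniz lebesgue_integral_count_space_finite)

text \<open>The solution of the recursion: the expansion of the numerator of Fredholm's resolvent,
\<open>det (1 - X)\<close> times \<open>X (1 - X)\<^sup>-\<^sup>1\<close>, in orders of \<open>X\<close>.\<close>

lemma bordered_integral_eq:
  assumes N: "finite_measure N" and X: "bdd_kernel N N X"
    and x: "x \<in> space N" and y: "y \<in> space N"
  shows "(-1) ^ p / fact p * bordered_integral N X p x y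
    = (\<Sum>q\<le>p. kpow N X q x y * fredholm_coeff N X (p - q))"
  using x
proof (induction p arbitrary: x)
  case 0
  then show ?case by (simp add: bordered_integral_0 fredholm_coeff_0)
next
  case (Suc p)
  have int: "integrable N (\<lambda>s. X x s * kpow N X q s y * c)" for q c
    using Suc.prems y bdd_kernel_row[OF X] bdd_kernel_col[OF bdd_kernel_kpow[OF N X]]
    by (intro bdd_meas_integrable[OF N] bdd_meas_mult) auto
  have "(-1) ^ p / fact p * kcomp N X (bordered_integral N X p) x y
      = (\<integral>s. X x s * ((-1) ^ p / fact p * bordered_integral N X p s y) \<partial>N)"
    unfolding kcomp_def by (subst integral_mult_right_zero[symmetric]) (simp add: algebra_simps)
  also have "\<dots> = (\<integral>s. X x s * (\<Sum>q\<le>p. kpow N X q s y * fredholm_coeff N X (p - q)) \<partial>N)"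
    by (rule Bochner_Integration.integral_cong[OF refl]) (simp only: Suc.IH)
  also have "\<dots> = (\<Sum>q\<le>p. kpow N X (Suc q) x y * fredholm_coeff N X (p - q))"
    by (simp add: sum_distrib_left mult.assoc[symmetric] kcomp_def int Bochner_Integration.integral_sum)
  finally have *: "(-1) ^ p / fact p * kcomp N X (bordered_integral N X p) x y
      = (\<Sum>q\<le>p. kpow N X (Suc q) x y * fredholm_coeff N X (p - q))" .
  have "(-1) ^ Suc p / fact (Suc p) * bordered_integral N X (Suc p) x y
      = X x y * fredholm_coeff N X (Suc p) + (-1) ^ p / fact p * kcomp N X (bordered_integral N X p) x y"
    unfolding bordered_integral_Suc[OF N X Suc.prems y] fredholm_coeff_def
    by (simp add: field_simps del: of_nat_Suc)
  also have "\<dots> = (\<Sum>q\<le>Suc p. kpow N X q x y * fredholm_coeff N X (Suc p - q))"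
    unfolding * by (simp add: sum.atMost_Suc_shift del: sum.atMost_Suc)
  finally show ?case .
qed

text \<open>Setting \<open>x = y\<close> and integrating turns the preceding expansion into Newton's identities. They show that the
Fredholm series is determined, term by term, by the traces of the powers of \<open>X\<close>.\<close>

lemma fredholm_coeff_Newton:
  assumes N: "finite_measure N" and X: "bdd_kernel N N X"
  shows "of_nat (Suc p) * fredholm_coeff N X (Suc p)
    = - (\<Sum>q\<le>p. ktrace N (kpow N X q) * fredholm_coeff N X (p - q))"
proof -
  have int: "integrable N (\<lambda>s. kpow N X q s s * c)" for q c
    by (intro bdd_meas_integrable[OF N] bdd_meas_mult bdd_kernel_compose[OF bdd_kernel_kpow[OF N X]]) auto
  have "of_nat (Suc p) * fredholm_coeff N X (Suc p)
      = - (\<integral>x. (-1) ^ p / fact p * bordered_integral N X p x x \<partial>N)"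
    unfolding fredholm_coeff_def minor_integral_Suc[OF N X]
    by (simp add: field_simps del: of_nat_Suc)
  also have "(\<integral>x. (-1) ^ p / fact p * bordered_integral N X p x x \<partial>N)
      = (\<integral>x. (\<Sum>q\<le>p. kpow N X q x x * fredholm_coeff N X (p - q)) \<partial>N)"
    by (rule Bochner_Integration.integral_cong[OF refl]) (simp only: bordered_integral_eq[OF N X])
  also have "\<dots> = (\<Sum>q\<le>p. ktrace N (kpow N X q) * fredholm_coeff N X (p - q))"
    by (simp add: ktrace_def int Bochner_Integration.integral_sum)
  finally show ?thesis .
qed

text \<open>For such traces \<open>- log det (1 - z X) = \<Sum>\<^sub>r z ^ r tr (X ^ r) / r\<close> reduces to the same series for \<open>Y\<close> at \<open>z\<^sup>2\<close>; Newton's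
identities give this comparison without any convergence question.\<close>

lemma fredholm_coeff_even_traces:
  assumes N: "finite_measure N" and X: "bdd_kernel N N X"
    and N': "finite_measure N'" and Y: "bdd_kernel N' N' Y"
    and odd: "\<And>r. ktrace N (kpow N X (2 * r)) = 0"
    and even: "\<And>r. ktrace N (kpow N X (2 * r + 1)) = 2 * ktrace N' (kpow N' Y r)"
  shows "fredholm_coeff N X (2 * r) = fredholm_coeff N' Y r"
    and "fredholm_coeff N X (2 * r + 1) = 0"
proof -
  have vanish: "fredholm_coeff N X p = 0" if "Parity.odd p" for p
    using that
  proof (induction p rule: less_induct)
    case (less p)
    then obtain s where p: "p = Suc s" and s: "Parity.even s" by (cases p) auto
    have "ktrace N (kpow N X q) * fredholm_coeff N X (s - q) = 0" if "q \<le> s" for q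
    proof (cases "Parity.even q")
      case True
      then show ?thesis using odd by (auto elim!: evenE)
    next
      case False
      then have "Parity.odd (s - q)" using s that by simp
      then show ?thesis using less.IH[of "s - q"] p by simp
    qed
    then have "of_nat (Suc s) * fredholm_coeff N X (Suc s) = 0"
      unfolding fredholm_coeff_Newton[OF N X] by (simp add: sum.neutral)
    then show ?case by (simp add: p del: of_nat_Suc)
  qed
  then show "fredholm_coeff N X (2 * r + 1) = 0" by simp
  show "fredholm_coeff N X (2 * r) = fredholm_coeff N' Y r"
  proof (induction r rule: less_induct)
    case (less r)
    show ?case
    proof (cases r)
      case 0
      then show ?thesis by (simp add: fredholm_coeff_0)
    next
      case (Suc s)
      have "of_nat (2 * r) * fredholm_coeff N X (2 * r)
          = - (\<Sum>q\<le>2 * s + 1. ktrace N (kpow N X q) * fredholm_coeff N X (2 * s + 1 - q))"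
        using fredholm_coeff_Newton[OF N X, of "2 * s + 1"] by (simp add: Suc)
      also have "(\<Sum>q\<le>2 * s + 1. ktrace N (kpow N X q) * fredholm_coeff N X (2 * s + 1 - q))
          = (\<Sum>q\<in>(\<lambda>j. 2 * j + 1) ` {..s}. ktrace N (kpow N X q) * fredholm_coeff N X (2 * s + 1 - q))"
      proof (rule sum.mono_neutral_right)
        show "\<forall>q\<in>{..2 * s + 1} - (\<lambda>j. 2 * j + 1) ` {..s}.
            ktrace N (kpow N X q) * fredholm_coeff N X (2 * s + 1 - q) = 0"
        proof
          fix q assume q: "q \<in> {..2 * s + 1} - (\<lambda>j. 2 * j + 1) ` {..s}"
          have "Parity.even q"
          proof (rule ccontr)
            assume "\<not> Parity.even q"
            then obtain j where "q = 2 * j + 1" by (elim oddE)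
            then show False using q by auto
          qed
          then show "ktrace N (kpow N X q) * fredholm_coeff N X (2 * s + 1 - q) = 0"
            using odd by (auto elim!: evenE)
        qed
      qed auto
      also have "\<dots> = (\<Sum>j\<le>s. ktrace N (kpow N X (2 * j + 1)) * fredholm_coeff N X (2 * (s - j)))"
        by (subst sum.reindex) (auto simp: inj_on_def right_diff_distrib')
      also have "\<dots> = 2 * (\<Sum>j\<le>s. ktrace N' (kpow N' Y j) * fredholm_coeff N' Y (s - j))"
        unfolding sum_distrib_left
      proof (rule sum.cong[OF refl])
        fix j assume "j \<in> {..s}"
        have "fredholm_coeff N X (2 * (s - j)) = fredholm_coeff N' Y (s - j)"
          by (rule less) (simp add: Suc)
        then show "ktrace N (kpow N X (2 * j + 1)) * fredholm_coeff N X (2 * (s - j))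
            = 2 * (ktrace N' (kpow N' Y j) * fredholm_coeff N' Y (s - j))"
          unfolding even by simp
      qed
      also have "- \<dots> = 2 * (of_nat r * fredholm_coeff N' Y r)"
        using fredholm_coeff_Newton[OF N' Y, of s] by (simp add: Suc)
      finally have "of_nat (2 * r) * fredholm_coeff N X (2 * r) = of_nat (2 * r) * fredholm_coeff N' Y r"
        by simp
      moreover have "(of_nat (2 * r) :: complex) \<noteq> 0"
        unfolding of_nat_eq_0_iff using Suc by simp
      ultimately show ?thesis using mult_left_cancel by blast
    qed
  qed
qed

section \<open>Contour integrals as integrals over a finite measure space\<close>

text \<open>The difference quotients are dominated by means of Cauchy's inequality, so that differentiation
under the integral needs nothing but a uniform bound.\<close>

lemma holomorphic_on_integral:
  assumes P: "finite_measure P" and U: "open U"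
    and meas: "\<And>w. w \<in> U \<Longrightarrow> H w \<in> borel_measurable P"
    and bound: "\<And>w x. w \<in> U \<Longrightarrow> x \<in> space P \<Longrightarrow> norm (H w x :: complex) \<le> C"
    and hol: "\<And>x. x \<in> space P \<Longrightarrow> (\<lambda>w. H w x) holomorphic_on U"
  shows "(\<lambda>w. \<integral>x. H w x \<partial>P) holomorphic_on U"
  unfolding holomorphic_on_open[OF U]
proof
  fix w assume w: "w \<in> U"
  obtain e where e: "e > 0" "cball w e \<subseteq> U" using U w open_contains_cball by blast
  \<comment> \<open>One radius serves for the points near \<open>w\<close> and for the Cauchy circles around them.\<close>
  define r where "r = e / 2"
  have r: "r > 0" using e by (simp add: r_def)
  have sub: "cball y r \<subseteq> U" if "y \<in> ball w r" for y
  proof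
    fix z assume "z \<in> cball y r"
    then have "dist w z \<le> e" using that dist_triangle[of w z y] by (simp add: r_def)
    then show "z \<in> U" using e(2) by auto
  qed
  have subw: "ball w r \<subseteq> U" using sub[of w] r by (auto simp: subset_iff)
  interpret finite_measure P by fact
  have intH: "integrable P (H y)" if "y \<in> U" for y
    using that by (intro integrable_const_bound[where B = C]) (auto simp: meas bound)
  define D where "D x = deriv (\<lambda>w. H w x) w" for x
  have lip: "norm (H y x - H w x) \<le> C / r * norm (y - w)" if y: "y \<in> ball w r" and x: "x \<in> space P" for x y
  proof (rule field_differentiable_bound[where S = "ball w r" and f' = "deriv (\<lambda>w. H w x)"])
    fix z assume z: "z \<in> ball w r"
    have zU: "z \<in> U" using z subw by auto
    show "((\<lambda>w. H w x) has_field_derivative deriv (\<lambda>w. H w x) z) (at z within ball w r)"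
      using holomorphic_derivI[OF hol[OF x] U zU] by (rule has_field_derivative_at_within)
    have "norm ((deriv ^^ 1) (\<lambda>w. H w x) z) \<le> fact 1 * C / r ^ 1"
    proof (rule Cauchy_inequality)
      show "(\<lambda>w. H w x) holomorphic_on ball z r"
        using hol[OF x] holomorphic_on_subset sub[OF z] ball_subset_cball by blast
      show "continuous_on (cball z r) (\<lambda>w. H w x)"
        using hol[OF x] holomorphic_on_imp_continuous_on continuous_on_subset sub[OF z] by blast
      show "norm (H y x) \<le> C" if "norm (z - y) = r" for y
        using that sub[OF z] by (intro bound x) (auto simp: dist_norm subset_iff)
    qed fact
    then show "norm (deriv (\<lambda>w. H w x) z) \<le> C / r" by simp
  qed (use y r in auto)
  have "((\<lambda>y. ((\<integral>x. H y x \<partial>P) - (\<integral>x. H w x \<partial>P)) / (y - w)) \<longlongrightarrow> (\<integral>x. D x \<partial>P)) (at w within ball w r)"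
    unfolding tendsto_at_iff_sequentially
  proof (intro allI impI)
    fix X assume X: "\<forall>i::nat. X i \<in> ball w r - {w}" "X \<longlonglongrightarrow> w"
    have XU: "X i \<in> U" for i using X(1) subw by blast
    let ?Q = "\<lambda>i x. (H (X i) x - H w x) / (X i - w)"
    have lim: "(\<lambda>i. ?Q i x) \<longlonglongrightarrow> D x" if x: "x \<in> space P" for x
    proof -
      have "((\<lambda>w. H w x) has_field_derivative D x) (at w within ball w r)"
        unfolding D_def
        using holomorphic_derivI[OF hol[OF x] U w] by (rule has_field_derivative_at_within)
      then have "((\<lambda>y. (H y x - H w x) / (y - w)) \<longlongrightarrow> D x) (at w within ball w r)"
        by (simp add: has_field_derivative_iff)
      then show ?thesis using X unfolding tendsto_at_iff_sequentially by (simp add: o_def)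
    qed
    have measQ: "?Q i \<in> borel_measurable P" for i
      using meas[OF XU[of i]] meas[OF w] by measurable
    have "(\<lambda>i. \<integral>x. ?Q i x \<partial>P) \<longlonglongrightarrow> (\<integral>x. D x \<partial>P)"
    proof (rule integral_dominated_convergence[where w = "\<lambda>_. C / r"])
      show "D \<in> borel_measurable P"
        by (rule borel_measurable_LIMSEQ_metric[OF measQ lim])
      show "AE x in P. norm (?Q i x) \<le> C / r" for i
      proof (rule AE_I2)
        fix x assume "x \<in> space P"
        from lip[OF _ this, of "X i"] X(1) show "norm (?Q i x) \<le> C / r"
          by (simp add: norm_divide divide_le_eq)
      qed
    qed (use measQ lim in auto)
    moreover have "(\<integral>x. ?Q i x \<partial>P) = ((\<integral>x. H (X i) x \<partial>P) - (\<integral>x. H w x \<partial>P)) / (X i - w)" for i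
      by (simp add: intH[OF XU] intH[OF w])
    ultimately show "((\<lambda>y. ((\<integral>x. H y x \<partial>P) - (\<integral>x. H w x \<partial>P)) / (y - w)) \<circ> X) \<longlonglongrightarrow> (\<integral>x. D x \<partial>P)"
      unfolding o_def by (simp only:)
  qed
  then have "((\<lambda>y. \<integral>x. H y x \<partial>P) has_field_derivative (\<integral>x. D x \<partial>P)) (at w within ball w r)"
    by (simp add: has_field_derivative_iff)
  moreover have "at w within ball w r = at w" by (rule at_within_open) (use r in auto)
  ultimately show "\<exists>f'. ((\<lambda>w. \<integral>x. H w x \<partial>P) has_field_derivative f') (at w)" by auto
qed

text \<open>A valid path can have unbounded derivative near the finitely many break points and need not be rectifiable, so
that integrals of merely continuous functions along it may fail to exist, and Fubini's theorem
cannot be applied directly. Along a sufficiently close polynomial loop all holomorphic functions have the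
same integral, and this integral is an absolutely convergent one.\<close>

lemma polynomial_loop_homologous:
  assumes \<gamma>: "valid_path \<gamma>" "pathfinish \<gamma> = pathstart \<gamma>" and U: "open U" "path_image \<gamma> \<subseteq> U"
  obtains \<delta> \<delta>' :: "real \<Rightarrow> complex"
  where "continuous_on UNIV \<delta>" "continuous_on UNIV \<delta>'" "\<And>t. t \<in> {0..1} \<Longrightarrow> \<delta> t \<in> U"
    "\<And>h. h holomorphic_on U \<Longrightarrow> h contour_integrable_on \<gamma>"
    "\<And>h. h holomorphic_on U \<Longrightarrow>
       contour_integral \<gamma> h = (\<integral>t. h (\<delta> t) * \<delta>' t \<partial>restrict_space lborel {0..1})"
proof -
  have p: "path \<gamma>" using \<gamma>(1) by (rule valid_path_imp_path)
  obtain d where d: "d > 0" and near: "\<And>g h. valid_path g \<and> valid_path h \<and>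
      (\<forall>t \<in> {0..1}. norm (g t - \<gamma> t) < d \<and> norm (h t - \<gamma> t) < d) \<and>
      pathfinish g = pathstart g \<and> pathfinish h = pathstart h \<longrightarrow>
      path_image g \<subseteq> U \<and> path_image h \<subseteq> U \<and>
      (\<forall>f. f holomorphic_on U \<longrightarrow> contour_integral h f = contour_integral g f)"
    using contour_integral_nearby_loops[OF U(1) p U(2)] by blast
  obtain \<delta> where \<delta>: "polynomial_function \<delta>" "pathstart \<delta> = pathstart \<gamma>" "pathfinish \<delta> = pathfinish \<gamma>"
      "\<And>t. t \<in> {0..1} \<Longrightarrow> norm (\<delta> t - \<gamma> t) < d"
    using path_approx_polynomial_function[OF p d] by blast
  obtain \<delta>' where \<delta>': "polynomial_function \<delta>'" "\<And>t. (\<delta> has_vector_derivative \<delta>' t) (at t)"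
    using has_vector_derivative_polynomial_function[OF \<delta>(1)] by blast
  have "path_image \<delta> \<subseteq> U" and eq: "\<And>f. f holomorphic_on U \<Longrightarrow> contour_integral \<delta> f = contour_integral \<gamma> f"
    using near[of \<gamma> \<delta>] \<gamma> \<delta> d valid_path_polynomial_function[OF \<delta>(1)] by auto
  then have \<delta>U: "\<And>t. t \<in> {0..1} \<Longrightarrow> \<delta> t \<in> U" by (auto simp: path_image_def)
  have c: "continuous_on S \<delta>" "continuous_on S \<delta>'" for S
    using \<delta>(1) \<delta>'(1) by (auto intro: continuous_on_polymonial_function)
  show ?thesis
  proof (rule that[of \<delta> \<delta>'])
    fix h assume h: "h holomorphic_on U"
    show "h contour_integrable_on \<gamma>"
      by (rule contour_integrable_holomorphic_simple[OF h U(1) \<gamma>(1) U(2)])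
    have "continuous_on {0..1} (\<lambda>t. h (\<delta> t) * \<delta>' t)"
      using \<delta>U by (intro continuous_on_mult c continuous_on_compose2[OF holomorphic_on_imp_continuous_on[OF h]]) auto
    then have int: "set_integrable lborel {0..1} (\<lambda>t. h (\<delta> t) * \<delta>' t)"
      by (rule borel_integrable_atLeastAtMost')
    have "contour_integral \<gamma> h = contour_integral \<delta> h" using eq[OF h] by simp
    also have "\<dots> = integral {0..1} (\<lambda>t. h (\<delta> t) * \<delta>' t)"
      unfolding contour_integral_integral using vector_derivative_at[OF \<delta>'(2)] by simp
    also have "\<dots> = (LINT t:{0..1}|lborel. h (\<delta> t) * \<delta>' t)"
      by (rule set_borel_integral_eq_integral(2)[OF int, symmetric])
    also have "\<dots> = (\<integral>t. h (\<delta> t) * \<delta>' t \<partial>restrict_space lborel {0..1})"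
      by (simp add: set_lebesgue_integral_def integral_restrict_space)
    finally show "contour_integral \<gamma> h = (\<integral>t. h (\<delta> t) * \<delta>' t \<partial>restrict_space lborel {0..1})" .
  qed (use c \<delta>U in auto)
qed

lemma bdd_meas_holomorphic:
  assumes "open V" "h holomorphic_on V" "\<And>z. z \<in> V \<Longrightarrow> norm (h z) \<le> C"
  shows "bdd_meas borel (\<lambda>z. indicator V z * h z)"
proof (rule bdd_measI[where C = "max C 0"])
  have "(\<lambda>z. indicator V z *\<^sub>R h z) \<in> borel_measurable borel"
    using assms holomorphic_on_imp_continuous_on by (intro borel_measurable_continuous_on_indicator) auto
  moreover have "(\<lambda>z. indicator V z *\<^sub>R h z) = (\<lambda>z. indicator V z * h z)"
    by (auto simp: indicator_def)
  ultimately show "(\<lambda>z. indicator V z * h z) \<in> borel_measurable borel" by simp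
  show "norm (indicator V z * h z) \<le> max C 0" for z
    using assms(3)[of z] by (auto simp: indicator_def)
qed

text \<open>The two contours are represented simultaneously by a finite measure space with a point map \<open>g\<close> and a
complex weight \<open>w\<close>; the representation is correct only for functions holomorphic on the
neighbourhoods \<open>U1\<close>, \<open>U2\<close> of the contours. Disjointness of the neighbourhoods allows a function to be
prescribed independently on each of them.\<close>

locale contour_pair =
  fixes \<gamma>1 \<gamma>2 :: "real \<Rightarrow> complex" and U1 U2 :: "complex set"
    and N :: "'a measure" and g w :: "'a \<Rightarrow> complex"
  assumes finite_N: "finite_measure N" and g [measurable]: "g \<in> borel_measurable N" and w: "bdd_meas N w"
    and U: "open U1" "open U2" "U1 \<inter> U2 = {}" and images: "path_image \<gamma>1 \<subseteq> U1" "path_image \<gamma>2 \<subseteq> U2"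
    and gU: "\<And>s. s \<in> space N \<Longrightarrow> g s \<in> U1 \<union> U2"
    and integrable1: "\<And>h. h holomorphic_on U1 \<Longrightarrow> h contour_integrable_on \<gamma>1"
    and integrable2: "\<And>h. h holomorphic_on U2 \<Longrightarrow> h contour_integrable_on \<gamma>2"
    and integral1: "\<And>h. h holomorphic_on U1 \<Longrightarrow>
          contour_integral \<gamma>1 h = (\<integral>s. indicator U1 (g s) * h (g s) * w s \<partial>N)"
    and integral2: "\<And>h. h holomorphic_on U2 \<Longrightarrow>
          contour_integral \<gamma>2 h = (\<integral>s. indicator U2 (g s) * h (g s) * w s \<partial>N)"

text \<open>Two copies of the unit interval, carrying the two polynomial loops and their derivatives.\<close>

lemma contour_pair_exists:
  assumes \<gamma>1: "valid_path \<gamma>1" "pathfinish \<gamma>1 = pathstart \<gamma>1" and \<gamma>2: "valid_path \<gamma>2" "pathfinish \<gamma>2 = pathstart \<gamma>2"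
    and U: "open U1" "open U2" "U1 \<inter> U2 = {}" and images: "path_image \<gamma>1 \<subseteq> U1" "path_image \<gamma>2 \<subseteq> U2"
  obtains N :: "(bool \<times> real) measure" and g w where "contour_pair \<gamma>1 \<gamma>2 U1 U2 N g w"
proof -
  let ?L = "restrict_space lborel {0..1::real}"
  define N where "N = count_space (UNIV :: bool set) \<Otimes>\<^sub>M ?L"
  obtain \<delta>1 \<delta>1' where \<delta>1: "continuous_on UNIV \<delta>1" "continuous_on UNIV \<delta>1'" "\<And>t. t \<in> {0..1} \<Longrightarrow> \<delta>1 t \<in> U1"
    and i1: "\<And>h. h holomorphic_on U1 \<Longrightarrow> h contour_integrable_on \<gamma>1"
      "\<And>h. h holomorphic_on U1 \<Longrightarrow> contour_integral \<gamma>1 h = (\<integral>t. h (\<delta>1 t) * \<delta>1' t \<partial>?L)"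
    using polynomial_loop_homologous[OF \<gamma>1 U(1) images(1)] by metis
  obtain \<delta>2 \<delta>2' where \<delta>2: "continuous_on UNIV \<delta>2" "continuous_on UNIV \<delta>2'" "\<And>t. t \<in> {0..1} \<Longrightarrow> \<delta>2 t \<in> U2"
    and i2: "\<And>h. h holomorphic_on U2 \<Longrightarrow> h contour_integrable_on \<gamma>2"
      "\<And>h. h holomorphic_on U2 \<Longrightarrow> contour_integral \<gamma>2 h = (\<integral>t. h (\<delta>2 t) * \<delta>2' t \<partial>?L)"
    using polynomial_loop_homologous[OF \<gamma>2 U(2) images(2)] by metis
  define g where "g = (\<lambda>(b, t). if b then \<delta>1 t else \<delta>2 t)"
  define w where "w = (\<lambda>(b, t). if b then \<delta>1' t else \<delta>2' t)"
  have [measurable]: "\<delta>1 \<in> borel_measurable borel" "\<delta>1' \<in> borel_measurable borel"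
      "\<delta>2 \<in> borel_measurable borel" "\<delta>2' \<in> borel_measurable borel"
    using \<delta>1 \<delta>2 by (auto intro: borel_measurable_continuous_onI)
  have "emeasure ?L (space ?L) \<noteq> \<infinity>" by (simp add: emeasure_restrict_space space_restrict_space)
  then have L: "finite_measure ?L" by (rule finite_measureI)
  have B: "finite_measure (count_space (UNIV :: bool set))" by (rule finite_measure_count_space) simp
  interpret L: finite_measure ?L by (rule L)
  interpret B: finite_measure "count_space (UNIV :: bool set)" by (rule B)
  interpret BL: pair_sigma_finite "count_space (UNIV :: bool set)" ?L ..
  have N: "finite_measure N" unfolding N_def using B L by (simp add: finite_measure_pair_measure)
  have spN: "space N = UNIV \<times> {0..1}" by (simp add: N_def space_pair_measure space_restrict_space)
  have snd: "snd \<in> borel_measurable N"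
    unfolding N_def using measurable_compose[OF measurable_snd measurable_restrict_space1[OF measurable_ident_sets[of lborel borel]]]
    by simp
  have fst: "Measurable.pred N fst" unfolding N_def by simp
  note [measurable] = fst snd
  have gm: "g \<in> borel_measurable N" unfolding g_def case_prod_unfold by measurable
  have wm: "w \<in> borel_measurable N" unfolding w_def case_prod_unfold by measurable
  have "\<exists>C. \<forall>t\<in>{0..1}. norm (f t) \<le> C" if "continuous_on UNIV f" for f :: "real \<Rightarrow> complex"
  proof -
    have "compact (f ` {0..1})" using that continuous_on_subset by (intro compact_continuous_image) auto
    then show ?thesis using compact_imp_bounded bounded_iff by (metis imageI)
  qed
  then obtain C1 C2 where C: "\<And>t. t \<in> {0..1} \<Longrightarrow> norm (\<delta>1' t) \<le> C1" "\<And>t. t \<in> {0..1} \<Longrightarrow> norm (\<delta>2' t) \<le> C2"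
    using \<delta>1(2) \<delta>2(2) by metis
  have wb: "bdd_meas N w"
    by (rule bdd_measI[OF wm, where C = "max C1 C2"])
      (use C in \<open>auto simp: spN w_def le_max_iff_disj split: if_splits\<close>)
  have split: "(\<integral>s. (if fst s = b then f (snd s) else 0) \<partial>N) = (\<integral>t. f t \<partial>?L)"
    if f: "continuous_on {0..1} f" for f :: "real \<Rightarrow> complex" and b
  proof -
    have fm: "f \<in> borel_measurable ?L"
      using borel_measurable_continuous_on_restrict[OF f]
      by (simp cong: measurable_cong_sets add: sets_restrict_space)
    have "compact (f ` {0..1})" using f by (intro compact_continuous_image) auto
    then obtain C where C: "\<And>t. t \<in> {0..1} \<Longrightarrow> norm (f t) \<le> C"
      using compact_imp_bounded bounded_iff by (metis imageI)
    have m: "(\<lambda>s. if fst s = b then f (snd s) else 0) \<in> borel_measurable N"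
      unfolding N_def using fm by measurable
    have "integrable N (\<lambda>s. if fst s = b then f (snd s) else 0)"
      by (rule bdd_meas_integrable[OF N], rule bdd_measI[OF m, where C = "max C 0"])
        (use C in \<open>auto simp: spN le_max_iff_disj\<close>)
    then have "(\<integral>s. (if fst s = b then f (snd s) else 0) \<partial>N)
        = (\<integral>c. (\<integral>t. (if c = b then f t else 0) \<partial>?L) \<partial>count_space UNIV)"
      unfolding N_def by (subst BL.integral_fst'[symmetric]) (simp_all cong: if_cong)
    also have "\<dots> = (\<Sum>c\<in>UNIV. \<integral>t. (if c = b then f t else 0) \<partial>?L)"
      by (rule lebesgue_integral_count_space_finite) simp
    also have "\<dots> = (\<integral>t. f t \<partial>?L)" by (cases b) (simp_all add: UNIV_bool)
    finally show ?thesis .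
  qed
  have cont: "continuous_on {0..1} (\<lambda>t. h (\<delta> t) * \<delta>' t)"
    if "h holomorphic_on V" "continuous_on UNIV \<delta>" "continuous_on UNIV \<delta>'" "\<And>t. t \<in> {0..1} \<Longrightarrow> \<delta> t \<in> V"
    for h V and \<delta> \<delta>' :: "real \<Rightarrow> complex"
    using that continuous_on_subset[OF that(2)] continuous_on_subset[OF that(3)]
    by (intro continuous_on_mult continuous_on_compose2[OF holomorphic_on_imp_continuous_on[OF that(1)]]) auto
  have "contour_pair \<gamma>1 \<gamma>2 U1 U2 N g w"
  proof (rule contour_pair.intro)
    fix h assume h: "h holomorphic_on U1"
    have "contour_integral \<gamma>1 h = (\<integral>s. (if fst s = True then h (\<delta>1 (snd s)) * \<delta>1' (snd s) else 0) \<partial>N)"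
      using split[OF cont[OF h \<delta>1], of True] i1(2)[OF h] by simp
    also have "\<dots> = (\<integral>s. indicator U1 (g s) * h (g s) * w s \<partial>N)"
      by (rule Bochner_Integration.integral_cong)
        (use U(3) \<delta>1(3) \<delta>2(3) in \<open>auto simp: g_def w_def spN indicator_def disjoint_iff split: if_splits\<close>)
    finally show "contour_integral \<gamma>1 h = (\<integral>s. indicator U1 (g s) * h (g s) * w s \<partial>N)" .
  next
    fix h assume h: "h holomorphic_on U2"
    have "contour_integral \<gamma>2 h = (\<integral>s. (if fst s = False then h (\<delta>2 (snd s)) * \<delta>2' (snd s) else 0) \<partial>N)"
      using split[OF cont[OF h \<delta>2], of False] i2(2)[OF h] by simp
    also have "\<dots> = (\<integral>s. indicator U2 (g s) * h (g s) * w s \<partial>N)"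
      by (rule Bochner_Integration.integral_cong)
        (use U(3) \<delta>1(3) \<delta>2(3) in \<open>auto simp: g_def w_def spN indicator_def disjoint_iff split: if_splits\<close>)
    finally show "contour_integral \<gamma>2 h = (\<integral>s. indicator U2 (g s) * h (g s) * w s \<partial>N)" .
  next
    fix s assume "s \<in> space N"
    then show "g s \<in> U1 \<union> U2" using \<delta>1(3) \<delta>2(3) by (auto simp: g_def spN)
  qed (fact N gm wb U images i1(1) i2(1))+
  then show thesis by (rule that)
qed


context contour_pair
begin

lemma contours_holomorphic:
  assumes F: "F holomorphic_on U1 \<union> U2" and bound: "\<And>z. z \<in> U1 \<union> U2 \<Longrightarrow> norm (F z) \<le> C"
  shows "\<forall>\<gamma> \<in> set [\<gamma>1, \<gamma>2]. F contour_integrable_on \<gamma>"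
    and "contours_integral [\<gamma>1, \<gamma>2] F = (\<integral>s. F (g s) * w s \<partial>N)"
proof -
  have F1: "F holomorphic_on U1" and F2: "F holomorphic_on U2"
    using F by (auto intro: holomorphic_on_subset)
  show "\<forall>\<gamma> \<in> set [\<gamma>1, \<gamma>2]. F contour_integrable_on \<gamma>" using integrable1[OF F1] integrable2[OF F2] by simp
  have b: "integrable N (\<lambda>s. indicator V (g s) * F (g s) * w s)"
    if "open V" "F holomorphic_on V" "V \<subseteq> U1 \<union> U2" for V
    by (intro bdd_meas_integrable[OF finite_N] bdd_meas_mult w
        bdd_meas_compose[OF bdd_meas_holomorphic[OF that(1,2), of C] g]) (use that bound in auto)
  have "contours_integral [\<gamma>1, \<gamma>2] F
      = (\<integral>s. indicator U1 (g s) * F (g s) * w s + indicator U2 (g s) * F (g s) * w s \<partial>N)"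
    using b[OF U(1) F1] b[OF U(2) F2]
    by (simp add: contours_integral_def integral1[OF F1] integral2[OF F2])
  also have "\<dots> = (\<integral>s. F (g s) * w s \<partial>N)"
    by (rule Bochner_Integration.integral_cong) (use gU U(3) in \<open>auto simp: indicator_def\<close>)
  finally show "contours_integral [\<gamma>1, \<gamma>2] F = (\<integral>s. F (g s) * w s \<partial>N)" .
qed

text \<open>Holomorphy in each variable is inherited by the partially integrated function, so that at each
level of the iterated integral the contours can be replaced by the measure.\<close>

lemma contours_power_holomorphic:
  assumes local: "\<And>z z'. (\<And>i. i < p \<Longrightarrow> z i = z' i) \<Longrightarrow> f z = f z'"
    and meas: "f \<in> borel_measurable (PiM {..<p} (\<lambda>_. borel))"
    and bound: "\<And>z. (\<And>i. i < p \<Longrightarrow> z i \<in> U1 \<union> U2) \<Longrightarrow> norm (f z) \<le> C"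
    and hol: "\<And>z i. i < p \<Longrightarrow> (\<And>j. j < p \<Longrightarrow> z j \<in> U1 \<union> U2)
        \<Longrightarrow> (\<lambda>v. f (z(i := v))) holomorphic_on U1 \<union> U2"
  shows "contours_power_integrable [\<gamma>1, \<gamma>2] p f"
    and "contours_integral_power [\<gamma>1, \<gamma>2] p f
      = (\<integral>x. f (\<lambda>i. g (x i)) * (\<Prod>i<p. w (x i)) \<partial>PiM {..<p} (\<lambda>_. N))"
proof -
  have "contours_power_integrable [\<gamma>1, \<gamma>2] p f \<and> contours_integral_power [\<gamma>1, \<gamma>2] p f
      = (\<integral>x. f (\<lambda>i. g (x i)) * (\<Prod>i<p. w (x i)) \<partial>PiM {..<p} (\<lambda>_. N))"
    using assms
  proof (induction p arbitrary: f)
    case 0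
    have "f (\<lambda>i. g undefined) = f (\<lambda>_. 0)" by (rule 0(1)) simp
    then show ?case by (simp add: PiM_empty lebesgue_integral_count_space_finite)
  next
    case (Suc p f)
    let ?U = "U1 \<union> U2"
    let ?P = "\<lambda>p. PiM {..<p} (\<lambda>_. N)"
    let ?g = "\<lambda>x i. g (x i)"
    have intP: "finite_measure (?P q)" for q :: nat by (intro finite_measure_PiM finite_N) simp
    have fm: "(\<lambda>x. f (u x)) \<in> borel_measurable M"
      if "\<And>i. i < Suc p \<Longrightarrow> (\<lambda>x. u x i) \<in> borel_measurable M" for u and M :: "'z measure"
    proof -
      have "(\<lambda>x. \<lambda>i\<in>{..<Suc p}. u x i) \<in> measurable M (PiM {..<Suc p} (\<lambda>_. borel))"
        by (rule measurable_restrict) (use that in auto)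
      from measurable_compose[OF this Suc.prems(2)] 
      have "(\<lambda>x. f (\<lambda>i\<in>{..<Suc p}. u x i)) \<in> borel_measurable M" .
      moreover have "f (\<lambda>i\<in>{..<Suc p}. u x i) = f (u x)" for x by (rule Suc.prems(1)) simp
      ultimately show ?thesis by simp
    qed
    have gU': "g (x i) \<in> ?U" if "x \<in> space (?P q)" "i < q" for x i q
      using that gU by (auto simp: space_PiM)
    define F where "F v = (\<integral>x. f ((?g x)(p := v)) * (\<Prod>i<p. w (x i)) \<partial>?P p)" for v
    have slice: "contours_power_integrable [\<gamma>1, \<gamma>2] p (\<lambda>z. f (z(p := v)))"
        "contours_integral_power [\<gamma>1, \<gamma>2] p (\<lambda>z. f (z(p := v))) = F v" if v: "v \<in> ?U" for v
    proof -
      have "contours_power_integrable [\<gamma>1, \<gamma>2] p (\<lambda>z. f (z(p := v))) \<and>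
        contours_integral_power [\<gamma>1, \<gamma>2] p (\<lambda>z. f (z(p := v)))
        = (\<integral>x. f ((\<lambda>i. g (x i))(p := v)) * (\<Prod>i<p. w (x i)) \<partial>PiM {..<p} (\<lambda>_. N))"
      proof (rule Suc.IH)
        fix z z' :: "nat \<Rightarrow> complex" assume "\<And>i. i < p \<Longrightarrow> z i = z' i"
        then show "f (z(p := v)) = f (z'(p := v))" by (intro Suc.prems(1)) (auto simp: less_Suc_eq)
      next
        show "(\<lambda>z. f (z(p := v))) \<in> borel_measurable (PiM {..<p} (\<lambda>_. borel))"
          by (rule fm, rule measurable_upd_component) auto
      next
        fix z :: "nat \<Rightarrow> complex" assume "\<And>i. i < p \<Longrightarrow> z i \<in> ?U"
        then show "norm (f (z(p := v))) \<le> C" using v by (intro Suc.prems(3)) (auto simp: less_Suc_eq)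
      next
        fix z :: "nat \<Rightarrow> complex" and i assume i: "i < p" and z: "\<And>j. j < p \<Longrightarrow> z j \<in> ?U"
        have "(\<lambda>y. f ((z(p := v))(i := y))) holomorphic_on ?U"
          using v i z by (intro Suc.prems(4)) (auto simp: less_Suc_eq)
        then show "(\<lambda>y. f ((z(i := y))(p := v))) holomorphic_on ?U"
          using i by (simp add: fun_upd_twist)
      qed
      then show "contours_power_integrable [\<gamma>1, \<gamma>2] p (\<lambda>z. f (z(p := v)))"
        "contours_integral_power [\<gamma>1, \<gamma>2] p (\<lambda>z. f (z(p := v))) = F v" by (simp_all add: F_def)
    qed
    have wp: "bdd_meas (?P q) (\<lambda>x. \<Prod>i<q. w (x i))" for q
      by (intro bdd_meas_prod bdd_meas_compose[OF w]) auto
    then obtain D where D: "\<And>x. x \<in> space (?P p) \<Longrightarrow> norm (\<Prod>i<p. w (x i)) \<le> D"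
      unfolding bdd_meas_def by blast
    have bound: "norm (f ((?g x)(p := v)) * (\<Prod>i<p. w (x i))) \<le> C * D"
      if "v \<in> ?U" "x \<in> space (?P p)" for v x
    proof -
      have "norm (f ((?g x)(p := v))) \<le> C"
        using that gU' by (intro Suc.prems(3)) (auto simp: less_Suc_eq)
      then show ?thesis unfolding norm_mult
        using D[OF that(2)] order_trans[OF norm_ge_zero] by (intro mult_mono) auto
    qed
    have F_hol: "F holomorphic_on ?U" unfolding F_def
    proof (rule holomorphic_on_integral[OF intP])
      show "open ?U" using U by auto
      fix v assume "v \<in> ?U"
      have "(\<lambda>x. f ((?g x)(p := v))) \<in> borel_measurable (?P p)"
        by (rule fm, rule measurable_upd_component) (auto intro!: measurable_compose[OF _ g])
      then show "(\<lambda>x. f ((?g x)(p := v)) * (\<Prod>i<p. w (x i))) \<in> borel_measurable (?P p)"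
        using wp[of p] by (auto simp: bdd_meas_def)
    next
      fix x assume x: "x \<in> space (?P p)"
      consider v0 where "v0 \<in> ?U" | "?U = {}" by blast
      then show "(\<lambda>v. f ((?g x)(p := v)) * (\<Prod>i<p. w (x i))) holomorphic_on ?U"
      proof cases
        case 1
        have "(\<lambda>v. f (((?g x)(p := v0))(p := v))) holomorphic_on ?U"
          using 1 gU'[OF x] by (intro Suc.prems(4)) (auto simp: less_Suc_eq)
        then show ?thesis by (intro holomorphic_on_mult holomorphic_on_const) simp
      qed (auto simp: holomorphic_on_def)
    qed (fact bound)
    have F_bound: "norm (F v) \<le> C * D * measure (?P p) (space (?P p))" if v: "v \<in> ?U" for v
    proof -
      interpret finite_measure "?P p" by (rule intP)
      have "(\<lambda>x. f ((?g x)(p := v))) \<in> borel_measurable (?P p)"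
        by (rule fm, rule measurable_upd_component) (auto intro!: measurable_compose[OF _ g])
      then have i: "integrable (?P p) (\<lambda>x. f ((?g x)(p := v)) * (\<Prod>i<p. w (x i)))"
        using wp[of p] bound[OF v]
        by (intro bdd_meas_integrable[OF intP] bdd_measI[where C = "C * D"]) (auto simp: bdd_meas_def)
      have "norm (F v) \<le> (\<integral>x. norm (f ((?g x)(p := v)) * (\<Prod>i<p. w (x i))) \<partial>?P p)"
        unfolding F_def by (rule integral_norm_bound)
      also have "\<dots> \<le> (\<integral>x. C * D \<partial>?P p)"
        by (rule integral_mono) (use i bound[OF v] in auto)
      finally show ?thesis by (simp add: mult_ac)
    qed
    have F: "\<forall>\<gamma> \<in> set [\<gamma>1, \<gamma>2]. F contour_integrable_on \<gamma>"
      by (rule contours_holomorphic(1)[OF F_hol], rule F_bound)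
    have F_int: "contours_integral [\<gamma>1, \<gamma>2] F = (\<integral>s. F (g s) * w s \<partial>N)"
      by (rule contours_holomorphic(2)[OF F_hol], rule F_bound)
    have onU: "v \<in> ?U" if "\<gamma> \<in> set [\<gamma>1, \<gamma>2]" "v \<in> path_image \<gamma>" for \<gamma> v
      using that images by auto
    have "contours_power_integrable [\<gamma>1, \<gamma>2] (Suc p) f"
      unfolding contours_power_integrable.simps
    proof (intro ballI conjI)
      fix \<gamma> assume \<gamma>: "\<gamma> \<in> set [\<gamma>1, \<gamma>2]"
      show "contours_power_integrable [\<gamma>1, \<gamma>2] p (\<lambda>z. f (z(p := v)))" if "v \<in> path_image \<gamma>" for v
        by (rule slice(1)[OF onU[OF \<gamma> that]])
      show "(\<lambda>v. contours_integral_power [\<gamma>1, \<gamma>2] p (\<lambda>z. f (z(p := v)))) contour_integrable_on \<gamma>"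
        by (rule contour_integrable_eq[OF bspec[OF F \<gamma>]]) (rule slice(2)[OF onU[OF \<gamma>], symmetric])
    qed
    moreover have "contours_integral_power [\<gamma>1, \<gamma>2] (Suc p) f = contours_integral [\<gamma>1, \<gamma>2] F"
      unfolding contours_integral_power.simps contours_integral_def
      by (intro arg_cong[where f = sum_list] map_cong refl contour_integral_eq slice(2) onU)
    moreover have "(\<integral>x. f (?g x) * (\<Prod>i<Suc p. w (x i)) \<partial>?P (Suc p)) = (\<integral>s. F (g s) * w s \<partial>N)"
    proof -
      have "bdd_meas (?P (Suc p)) (\<lambda>x. f (?g x))"
        using gU' by (intro bdd_measI[where C = C] fm Suc.prems(3)) auto
      then have "bdd_meas (?P (Suc p)) (\<lambda>x. f (?g x) * (\<Prod>i<Suc p. w (x i)))"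
        by (intro bdd_meas_mult wp)
      then have "(\<integral>x. f (?g x) * (\<Prod>i<Suc p. w (x i)) \<partial>?P (Suc p))
          = (\<integral>s. \<integral>x. f (?g (x(p := s))) * (\<Prod>i<Suc p. w ((x(p := s)) i)) \<partial>?P p \<partial>N)"
        using PiM_insert_integral[OF finite_N, of "{..<p}" p] by (simp add: lessThan_Suc)
      also have "\<dots> = (\<integral>s. F (g s) * w s \<partial>N)"
      proof (rule Bochner_Integration.integral_cong[OF refl])
        fix s
        have "?g (x(p := s)) = (?g x)(p := g s)" for x by auto
        then have "f (?g (x(p := s))) * (\<Prod>i<Suc p. w ((x(p := s)) i))
            = f ((?g x)(p := g s)) * (\<Prod>i<p. w (x i)) * w s" for x
          by simp
        then show "(\<integral>x. f (?g (x(p := s))) * (\<Prod>i<Suc p. w ((x(p := s)) i)) \<partial>?P p) = F (g s) * w s"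
          by (simp only: F_def integral_mult_left_zero)
      qed
      finally show ?thesis .
    qed
    ultimately show ?case using F_int by simp
  qed
  then show "contours_power_integrable [\<gamma>1, \<gamma>2] p f"
    "contours_integral_power [\<gamma>1, \<gamma>2] p f
      = (\<integral>x. f (\<lambda>i. g (x i)) * (\<Prod>i<p. w (x i)) \<partial>PiM {..<p} (\<lambda>_. N))" by simp_all
qed

end

lemma contours_power_cong:
  assumes "\<And>z. (\<And>i. i < p \<Longrightarrow> z i \<in> (\<Union>\<gamma>\<in>set \<Gamma>. path_image \<gamma>)) \<Longrightarrow> f z = f' z"
  shows "contours_integral_power \<Gamma> p f = contours_integral_power \<Gamma> p f'"
    and "contours_power_integrable \<Gamma> p f \<longleftrightarrow> contours_power_integrable \<Gamma> p f'"
proof -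
  have "contours_integral_power \<Gamma> p f = contours_integral_power \<Gamma> p f' \<and>
      (contours_power_integrable \<Gamma> p f \<longleftrightarrow> contours_power_integrable \<Gamma> p f')"
    using assms
  proof (induction p arbitrary: f f')
    case (Suc p)
    have slice: "contours_integral_power \<Gamma> p (\<lambda>z. f (z(p := v))) = contours_integral_power \<Gamma> p (\<lambda>z. f' (z(p := v)))"
        "contours_power_integrable \<Gamma> p (\<lambda>z. f (z(p := v))) \<longleftrightarrow> contours_power_integrable \<Gamma> p (\<lambda>z. f' (z(p := v)))"
      if "\<gamma> \<in> set \<Gamma>" "v \<in> path_image \<gamma>" for v \<gamma>
    proof -
      have "contours_integral_power \<Gamma> p (\<lambda>z. f (z(p := v))) = contours_integral_power \<Gamma> p (\<lambda>z. f' (z(p := v))) \<and>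
        (contours_power_integrable \<Gamma> p (\<lambda>z. f (z(p := v))) \<longleftrightarrow> contours_power_integrable \<Gamma> p (\<lambda>z. f' (z(p := v))))"
      proof (rule Suc.IH)
        fix z assume "\<And>i. i < p \<Longrightarrow> z i \<in> (\<Union>\<gamma>\<in>set \<Gamma>. path_image \<gamma>)"
        then show "f (z(p := v)) = f' (z(p := v))"
          using that by (intro Suc.prems) (auto simp: less_Suc_eq)
      qed
      then show "contours_integral_power \<Gamma> p (\<lambda>z. f (z(p := v))) = contours_integral_power \<Gamma> p (\<lambda>z. f' (z(p := v)))"
        "contours_power_integrable \<Gamma> p (\<lambda>z. f (z(p := v))) \<longleftrightarrow> contours_power_integrable \<Gamma> p (\<lambda>z. f' (z(p := v)))"
        by auto
    qed
    have "contours_integral_power \<Gamma> (Suc p) f = contours_integral_power \<Gamma> (Suc p) f'"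
      unfolding contours_integral_power.simps contours_integral_def
      by (intro arg_cong[where f = sum_list] map_cong refl contour_integral_eq slice(1))
    moreover have "(\<lambda>v. contours_integral_power \<Gamma> p (\<lambda>z. f (z(p := v)))) contour_integrable_on \<gamma> \<longleftrightarrow>
        (\<lambda>v. contours_integral_power \<Gamma> p (\<lambda>z. f' (z(p := v)))) contour_integrable_on \<gamma>"
      if "\<gamma> \<in> set \<Gamma>" for \<gamma>
      using slice(1)[OF that] contour_integrable_eq[of _ \<gamma>] by (auto intro: contour_integrable_eq)
    ultimately show ?case using slice(2) by simp
  qed simp
  then show "contours_integral_power \<Gamma> p f = contours_integral_power \<Gamma> p f'"
    "contours_power_integrable \<Gamma> p f \<longleftrightarrow> contours_power_integrable \<Gamma> p f'" by auto
qed

text \<open>The diagonal needs its own hypothesis, since a diagonal entry depends on \<open>z k\<close> through both arguments.\<close>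

lemma kernel_minor_holomorphic:
  assumes left: "\<And>y. y \<in> V \<Longrightarrow> (\<lambda>v. X v y) holomorphic_on V"
    and right: "\<And>x. x \<in> V \<Longrightarrow> (\<lambda>v. X x v) holomorphic_on V"
    and diag: "(\<lambda>v. X v v) holomorphic_on V"
    and z: "\<And>j. j < p \<Longrightarrow> z j \<in> V"
  shows "(\<lambda>v. kernel_minor X p (z(k := v))) holomorphic_on V"
  unfolding kernel_minor_eq_kminor kminor_leibniz
proof (intro holomorphic_intros)
  fix \<sigma> i assume \<sigma>: "\<sigma> \<in> {\<sigma>. \<sigma> permutes {0..<p}}" and i: "i \<in> {0..<p}"
  then have "\<sigma> i < p" using permutes_in_image[of \<sigma> "{0..<p}" i] by auto
  then show "(\<lambda>v. X ((z(k := v)) i) ((z(k := v)) (\<sigma> i))) holomorphic_on V"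
    using left right diag z i by (cases "i = k"; cases "\<sigma> i = k") auto
qed

lemma kernel_minor_scale:
  "kernel_minor (\<lambda>x y. X (g x) (g y) * w y) p x = kernel_minor X p (\<lambda>i. g (x i)) * (\<Prod>i<p. w (x i))"
proof -
  have "(\<Prod>i = 0..<p. X (g (x i)) (g (x (\<sigma> i))) * w (x (\<sigma> i)))
      = (\<Prod>i = 0..<p. X (g (x i)) (g (x (\<sigma> i)))) * (\<Prod>i<p. w (x i))"
    if "\<sigma> permutes {0..<p}" for \<sigma>
    using prod.permute[OF that, of "\<lambda>i. w (x i)"]
    by (simp add: prod.distrib o_def atLeast0LessThan)
  then show ?thesis
    by (simp add: kernel_minor_eq_kminor kminor_leibniz sum_distrib_right mult.assoc)
qed

context contour_pair
begin

text \<open>The kernel \<open>X'\<close>, given on the contours only, is replaced by an extension \<open>X\<close> to the neighbourhoods.\<close>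

lemma L2_fredholm_term_eq_fredholm_coeff:
  assumes meas: "(\<lambda>(x, y). X x y) \<in> borel_measurable (borel \<Otimes>\<^sub>M borel)"
    and bound: "\<And>x y. x \<in> U1 \<union> U2 \<Longrightarrow> y \<in> U1 \<union> U2 \<Longrightarrow> norm (X x y) \<le> C"
    and left: "\<And>y. y \<in> U1 \<union> U2 \<Longrightarrow> (\<lambda>v. X v y) holomorphic_on U1 \<union> U2"
    and right: "\<And>x. x \<in> U1 \<union> U2 \<Longrightarrow> (\<lambda>v. X x v) holomorphic_on U1 \<union> U2"
    and diag: "(\<lambda>v. X v v) holomorphic_on U1 \<union> U2"
    and eq: "\<And>x y. x \<in> path_image \<gamma>1 \<union> path_image \<gamma>2 \<Longrightarrow> y \<in> path_image \<gamma>1 \<union> path_image \<gamma>2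
        \<Longrightarrow> X' x y = X x y"
  shows "contours_power_integrable [\<gamma>1, \<gamma>2] p (kernel_minor X' p)"
    and "L2_fredholm_term [\<gamma>1, \<gamma>2] X' p = fredholm_coeff N (\<lambda>x y. X (g x) (g y) * w y) p"
proof -
  have "kernel_minor X' p z = kernel_minor X p z"
    if "\<And>i. i < p \<Longrightarrow> z i \<in> (\<Union>\<gamma>\<in>set [\<gamma>1, \<gamma>2]. path_image \<gamma>)" for z
    unfolding kernel_minor_eq_kminor using that by (intro kminor_cong eq) auto
  note cong = contours_power_cong[of p "[\<gamma>1, \<gamma>2]" "kernel_minor X' p" "kernel_minor X p", OF this]
  have local_dep: "kernel_minor X p z = kernel_minor X p z'" if "\<And>i. i < p \<Longrightarrow> z i = z' i" for z z'
    unfolding kernel_minor_eq_kminor using that by (intro kminor_cong) auto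
  have m: "kernel_minor X p \<in> borel_measurable (PiM {..<p} (\<lambda>_. borel))"
  proof -
    have "(\<lambda>z. X (z i) (z j)) \<in> borel_measurable (PiM {..<p} (\<lambda>_. borel))" if "i < p" "j < p" for i j
      using measurable_compose[OF measurable_Pair meas, of "\<lambda>z. z i" _ "\<lambda>z. z j"] that by simp
    moreover have "\<sigma> i < p" if "\<sigma> permutes {0..<p}" "i < p" for \<sigma> i
      using permutes_in_image[OF that(1), of i] that(2) by simp
    ultimately show ?thesis
      unfolding kernel_minor_eq_kminor[abs_def] kminor_leibniz
      by (intro borel_measurable_sum borel_measurable_times borel_measurable_prod borel_measurable_const) auto
  qed
  obtain B where B: "norm (kernel_minor X p z) \<le> B" if "\<And>i. i < p \<Longrightarrow> z i \<in> U1 \<union> U2" for z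
  proof
    fix z assume z: "\<And>i. i < p \<Longrightarrow> z i \<in> U1 \<union> U2"
    have "norm (X (z i) (z (\<sigma> i))) \<le> C" if "\<sigma> permutes {0..<p}" "i < p" for \<sigma> i
      using permutes_in_image[OF that(1), of i] that(2) by (intro bound z) auto
    then show "norm (kernel_minor X p z) \<le> (\<Sum>\<sigma>\<in>{\<sigma>. \<sigma> permutes {0..<p}}. \<Prod>i = 0..<p. C)"
      unfolding kernel_minor_eq_kminor kminor_leibniz
      by (intro sum_norm_le)
        (auto simp: norm_mult prod_norm[symmetric] sign_def simp del: prod_constant intro!: prod_mono)
  qed
  note power = contours_power_holomorphic[OF local_dep m B kernel_minor_holomorphic[OF left right diag]]
  show "contours_power_integrable [\<gamma>1, \<gamma>2] p (kernel_minor X' p)"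
    using power(1) cong(2) by blast
  show "L2_fredholm_term [\<gamma>1, \<gamma>2] X' p = fredholm_coeff N (\<lambda>x y. X (g x) (g y) * w y) p"
    unfolding L2_fredholm_term_def fredholm_coeff_def minor_integral_def kernel_minor_scale
    by (rule arg_cong[where f = "(*) _"], rule trans[OF cong(1) power(2)])
qed

end

section \<open>Vanishing contour integrals and iterated contour integrals\<close>

text \<open>All residues are enclosed both by \<open>\<gamma>\<close> and by every large circle, with winding number \<open>1\<close>; the integral over
the large circle tends to \<open>0\<close>.\<close>

lemma contour_integral_eq_0_of_decay:
  assumes \<gamma>: "positive_contour \<gamma>" and pts: "finite pts" "pts \<subseteq> inside (path_image \<gamma>)"
    and f: "f holomorphic_on - pts" and decay: "((\<lambda>z. z * f z) \<longlongrightarrow> 0) at_infinity"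
  shows "contour_integral \<gamma> f = 0"
proof -
  define I where "I = 2 * pi * \<i> * (\<Sum>p\<in>pts. residue f p)"
  have "path_image \<gamma> \<inter> pts = {}" using pts(2) inside_no_overlap[of "path_image \<gamma>"] by blast
  then have "contour_integral \<gamma> f = 2 * pi * \<i> * (\<Sum>p\<in>pts. winding_number \<gamma> p * residue f p)"
    using \<gamma> pts f by (intro Residue_theorem[where S = UNIV])
      (auto simp: positive_contour_def Compl_eq_Diff_UNIV)
  also have "\<dots> = I" unfolding I_def
    using \<gamma> pts(2) by (intro arg_cong2[where f = "(*)"] refl sum.cong) (auto simp: positive_contour_def)
  finally have \<gamma>I: "contour_integral \<gamma> f = I" .
  have "norm I \<le> \<epsilon>" if \<epsilon>: "\<epsilon> > 0" for \<epsilon>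
  proof -
    have "eventually (\<lambda>z. norm (z * f z) < \<epsilon> / (2 * pi)) at_infinity"
      using tendstoD[OF decay, of "\<epsilon> / (2 * pi)"] \<epsilon> by simp
    then obtain b where b: "\<And>z. b \<le> norm z \<Longrightarrow> norm (z * f z) < \<epsilon> / (2 * pi)"
      unfolding eventually_at_infinity by blast
    obtain C where C: "\<And>p. p \<in> pts \<Longrightarrow> norm p \<le> C"
      using finite_imp_bounded[OF pts(1)] bounded_iff by blast
    define R where "R = max 1 (max b (C + 1))"
    have R: "R \<ge> 1" "R \<ge> b" "R > C" by (auto simp: R_def)
    then have pts_R: "\<And>p. p \<in> pts \<Longrightarrow> norm p < R" using C by (meson le_less_trans)
    have "path_image (circlepath 0 R) \<inter> pts = {}" using R(1) pts_R by (auto simp: sphere_def)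
    then have "contour_integral (circlepath 0 R) f
        = 2 * pi * \<i> * (\<Sum>p\<in>pts. winding_number (circlepath 0 R) p * residue f p)"
      using pts f by (intro Residue_theorem[where S = UNIV]) (auto simp: Compl_eq_Diff_UNIV)
    also have "\<dots> = I" unfolding I_def
      using pts_R by (intro arg_cong2[where f = "(*)"] refl sum.cong) (auto simp: winding_number_circlepath)
    finally have circle: "contour_integral (circlepath 0 R) f = I" .
    have "f contour_integrable_on circlepath 0 R"
      using R(1) \<open>path_image (circlepath 0 R) \<inter> pts = {}\<close>
      by (intro contour_integrable_holomorphic_simple[OF f])
        (auto intro!: open_Compl finite_imp_closed pts(1))
    then have has: "(f has_contour_integral I) (circlepath 0 R)"
      using circle has_contour_integral_integral by fastforce
    have "norm I \<le> \<epsilon> / (2 * pi * R) * (2 * pi * R)"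
    proof (rule has_contour_integral_bound_circlepath[OF has])
      fix z :: complex assume "norm (z - 0) = R"
      then show "norm (f z) \<le> \<epsilon> / (2 * pi * R)"
        using b[of z] R(1,2) by (simp add: norm_mult field_simps)
    qed (use \<epsilon> R in auto)
    then show ?thesis using R(1) by simp
  qed
  then have "norm I \<le> 0" by (rule field_le_epsilon[of _ 0, simplified])
  then show ?thesis using \<gamma>I by simp
qed

lemma compact_neighbourhood:
  fixes A :: "complex set"
  assumes "compact A" "A \<noteq> {}" "open B" "A \<subseteq> B"
  obtains U K where "open U" "compact K" "A \<subseteq> U" "U \<subseteq> K" "K \<subseteq> B"
proof -
  obtain e where e: "e > 0" "{x. infdist x A \<le> e} \<subseteq> B"
    using compact_in_open_separated[OF assms(2,1,3,4)] by blast
  show ?thesis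
  proof (rule that[of "{x. infdist x A < e}" "{x. infdist x A \<le> e}"])
    show "open {x. infdist x A < e}"
      by (intro open_Collect_less continuous_intros)
    show "compact {x. infdist x A \<le> e}" by (rule compact_infdist_le[OF assms(2,1) e(1)])
  qed (use e assms in auto)
qed

lemma bdd_kernel_continuous:
  fixes f :: "complex \<Rightarrow> complex \<Rightarrow> complex"
  assumes V: "open V1" "open V2" "V1 \<subseteq> K1" "V2 \<subseteq> K2" and K: "compact K1" "compact K2"
    and f: "continuous_on (K1 \<times> K2) (\<lambda>(x, y). f x y)"
  shows "bdd_kernel borel borel (\<lambda>x y. indicator V1 x * indicator V2 y * f x y)"
proof -
  have "compact ((\<lambda>(x, y). f x y) ` (K1 \<times> K2))"
    by (intro compact_continuous_image f compact_Times K)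
  then obtain C where "\<forall>z \<in> (\<lambda>(x, y). f x y) ` (K1 \<times> K2). norm z \<le> C"
    using compact_imp_bounded bounded_iff by metis
  then have C: "\<And>x y. x \<in> K1 \<Longrightarrow> y \<in> K2 \<Longrightarrow> norm (f x y) \<le> C" by auto
  show ?thesis
  proof (rule bdd_measI[where C = "max C 0"])
    have "(\<lambda>z. indicator (V1 \<times> V2) z *\<^sub>R (case z of (x, y) \<Rightarrow> f x y)) \<in> borel_measurable borel"
      using V by (intro borel_measurable_continuous_on_indicator continuous_on_subset[OF f])
        (auto intro!: borel_open open_Times)
    moreover have "(\<lambda>z. indicator (V1 \<times> V2) z *\<^sub>R (case z of (x, y) \<Rightarrow> f x y))
        = (\<lambda>(x, y). indicator V1 x * indicator V2 y * f x y)"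
      by (auto simp: indicator_def fun_eq_iff)
    ultimately show "(\<lambda>(x, y). indicator V1 x * indicator V2 y * f x y) \<in> borel_measurable (borel \<Otimes>\<^sub>M borel)"
      by (simp add: borel_prod)
    show "norm (case z of (x, y) \<Rightarrow> indicator V1 x * indicator V2 y * f x y) \<le> max C 0" for z
      using C V by (cases z) (auto simp: indicator_def norm_mult le_max_iff_disj)
  qed
qed

context contour_pair
begin

text \<open>Fubini's theorem for the iterated integrals that define \<open>K\<close>. In the second form the integral over \<open>\<gamma>2\<close> is the
inner one, so that it can be evaluated by residues.\<close>

lemma iterated_contour_integral:
  assumes f: "bdd_kernel borel borel (\<lambda>u v. indicator U2 u * indicator U1 v * f u v)"
    and left: "\<And>v. v \<in> U1 \<Longrightarrow> (\<lambda>u. f u v) holomorphic_on U2"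
    and right: "\<And>u. u \<in> U2 \<Longrightarrow> f u holomorphic_on U1"
  shows "contour_integral \<gamma>2 (\<lambda>u. contour_integral \<gamma>1 (f u))
      = (\<integral>x. indicator U1 (g x) * w x * (\<integral>y. indicator U2 (g y) * f (g y) (g x) * w y \<partial>N) \<partial>N)"
    and "contour_integral \<gamma>2 (\<lambda>u. contour_integral \<gamma>1 (f u))
      = (\<integral>x. indicator U1 (g x) * w x * contour_integral \<gamma>2 (\<lambda>u. f u (g x)) \<partial>N)"
proof -
  let ?f = "\<lambda>u v. indicator U2 u * indicator U1 v * f u v"
  define \<Phi> where "\<Phi> u = (\<integral>x. indicator U1 (g x) * f u (g x) * w x \<partial>N)" for u
  obtain C where C: "\<And>u v. norm (?f u v) \<le> C" using f by (auto simp: bdd_meas_def space_pair_measure)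
  obtain D where D: "\<And>x. x \<in> space N \<Longrightarrow> norm (w x) \<le> D" using w by (auto simp: bdd_meas_def)
  have inner: "contour_integral \<gamma>1 (f u) = \<Phi> u" if "u \<in> U2" for u
    unfolding \<Phi>_def by (rule integral1[OF right[OF that]])
  have "\<Phi> holomorphic_on U2" unfolding \<Phi>_def
  proof (rule holomorphic_on_integral[OF finite_N U(2)])
    fix u assume u: "u \<in> U2"
    have "bdd_meas N (\<lambda>x. ?f u (g x) * w x)"
      by (intro bdd_meas_mult w bdd_kernel_compose[OF f, of "\<lambda>_. u" N g]) auto
    then show "(\<lambda>x. indicator U1 (g x) * f u (g x) * w x) \<in> borel_measurable N"
      using u by (simp add: bdd_meas_def)
    show "norm (indicator U1 (g x) * f u (g x) * w x) \<le> C * D" if "x \<in> space N" for x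
      using mult_mono[OF C[of u "g x"] D[OF that]] order_trans[OF norm_ge_zero C[of u "g x"]] u
      by (simp add: norm_mult)
  next
    fix x assume "x \<in> space N"
    show "(\<lambda>u. indicator U1 (g x) * f u (g x) * w x) holomorphic_on U2"
    proof (cases "g x \<in> U1")
      case True
      then show ?thesis by (intro holomorphic_on_mult holomorphic_on_const left)
    qed simp
  qed
  note \<Phi> = integral2[OF this]
  have bdd: "bdd_meas (N \<Otimes>\<^sub>M N) (\<lambda>(y, x). ?f (g y) (g x) * w x * w y)"
    unfolding case_prod_unfold
    by (intro bdd_meas_mult bdd_kernel_compose[OF f] bdd_meas_compose[OF w]) auto
  have "contour_integral \<gamma>2 (\<lambda>u. contour_integral \<gamma>1 (f u)) = contour_integral \<gamma>2 \<Phi>"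
    by (rule contour_integral_eq, rule inner) (use images in auto)
  also have "\<dots> = (\<integral>y. (\<integral>x. ?f (g y) (g x) * w x * w y \<partial>N) \<partial>N)"
  proof -
    have "indicator U2 (g y) * \<Phi> (g y) * w y = (\<integral>x. ?f (g y) (g x) * w x * w y \<partial>N)" for y
    proof -
      have "indicator U2 (g y) * \<Phi> (g y) * w y
          = (\<integral>x. indicator U2 (g y) * (indicator U1 (g x) * f (g y) (g x) * w x) * w y \<partial>N)"
        by (simp only: \<Phi>_def integral_mult_right_zero integral_mult_left_zero)
      then show ?thesis by (simp add: mult.assoc)
    qed
    then show ?thesis unfolding \<Phi> by (simp only:)
  qed
  also have "\<dots> = (\<integral>x. (\<integral>y. ?f (g y) (g x) * w x * w y \<partial>N) \<partial>N)"
    by (rule bdd_meas_Fubini[OF finite_N finite_N bdd])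
  also have "\<dots> = (\<integral>x. (\<integral>y. (indicator U1 (g x) * w x) * (indicator U2 (g y) * f (g y) (g x) * w y) \<partial>N) \<partial>N)"
    by (simp add: mult_ac)
  also have "\<dots> = (\<integral>x. indicator U1 (g x) * w x * (\<integral>y. indicator U2 (g y) * f (g y) (g x) * w y \<partial>N) \<partial>N)"
    by (simp only: integral_mult_right_zero)
  finally show 1: "contour_integral \<gamma>2 (\<lambda>u. contour_integral \<gamma>1 (f u))
      = (\<integral>x. indicator U1 (g x) * w x * (\<integral>y. indicator U2 (g y) * f (g y) (g x) * w y \<partial>N) \<partial>N)" .
  have "indicator U1 (g x) * w x * (\<integral>y. indicator U2 (g y) * f (g y) (g x) * w y \<partial>N)
      = indicator U1 (g x) * w x * contour_integral \<gamma>2 (\<lambda>u. f u (g x))" for x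
    using integral2[OF left[of "g x"]] by (cases "g x \<in> U1") simp_all
  then show "contour_integral \<gamma>2 (\<lambda>u. contour_integral \<gamma>1 (f u))
      = (\<integral>x. indicator U1 (g x) * w x * contour_integral \<gamma>2 (\<lambda>u. f u (g x)) \<partial>N)"
    unfolding 1 by (simp only:)
qed

end

section \<open>Fredholm series over finite sets\<close>

lemma kernel_minor_transpose: "kernel_minor (\<lambda>x y. X y x) p z = kernel_minor X p z"
proof -
  let ?A = "Matrix.mat p p (\<lambda>(i, j). X (z i) (z j))"
  have "Matrix.mat p p (\<lambda>(i, j). X (z j) (z i)) = transpose_mat ?A" by (rule eq_matI) auto
  then show ?thesis unfolding kernel_minor_def using det_transpose[of ?A p] by simp
qed

lemma kernel_minor_zero_row:
  assumes "i < p" "\<And>j. j < p \<Longrightarrow> X (z i) (z j) = 0"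
  shows "kernel_minor X p z = 0"
proof -
  have "(\<Prod>i = 0..<p. X (z i) (z (\<sigma> i))) = 0" if "\<sigma> permutes {0..<p}" for \<sigma>
    using permutes_in_image[OF that, of i] assms by (intro prod_zero bexI[of _ i]) auto
  then show ?thesis unfolding kernel_minor_eq_kminor kminor_leibniz by (intro sum.neutral) auto
qed

lemma kernel_minor_not_inj:
  assumes "\<not> inj_on z {..<p}"
  shows "kernel_minor X p z = 0"
proof -
  obtain i j where ij: "i < p" "j < p" "i \<noteq> j" "z i = z j" using assms by (auto simp: inj_on_def)
  let ?A = "Matrix.mat p p (\<lambda>(i, j). X (z i) (z j))"
  have "Determinant.det ?A = 0"
    by (rule det_identical_rows[of ?A p i j]) (use ij in \<open>auto intro!: eq_vecI\<close>)
  then show ?thesis by (simp add: kernel_minor_def)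
qed

lemma fredholm_coeff_count_space:
  assumes "finite J"
  shows "fredholm_coeff (count_space J) X p
    = (-1) ^ p / fact p * (\<Sum>z \<in> {..<p} \<rightarrow>\<^sub>E J. kernel_minor X p z)"
  unfolding fredholm_coeff_def minor_integral_def
  using assms by (subst count_space_PiM_finite)
    (auto simp: countable_finite lebesgue_integral_count_space_finite finite_PiE)

lemma fredholm_coeff_count_space_eq_0:
  assumes "finite J" "card J < p"
  shows "fredholm_coeff (count_space J) X p = 0"
proof -
  have "kernel_minor X p z = 0" if "z \<in> {..<p} \<rightarrow>\<^sub>E J" for z
  proof (rule kernel_minor_not_inj, rule notI)
    assume "inj_on z {..<p}"
    then have "card {..<p} \<le> card J" using that assms(1) by (intro card_inj_on_le) auto
    then show False using assms(2) by simp
  qed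
  then show ?thesis using assms(1) by (simp add: fredholm_coeff_count_space)
qed

text \<open>A principal minor with an index outside \<open>J\<close> contains a zero row, so that only the finite block with indices in \<open>J\<close>
contributes.\<close>

lemma l2_fredholm_term_finite:
  fixes K :: "int \<Rightarrow> int \<Rightarrow> complex"
  assumes J: "finite J" "J \<subseteq> I" and K: "\<And>n n'. n \<in> I - J \<Longrightarrow> n' \<in> I \<Longrightarrow> K n n' = 0"
  shows "kernel_minor K p summable_on ({..<p} \<rightarrow>\<^sub>E I)"
    and "l2_fredholm_term I K p = fredholm_coeff (count_space J) K p"
proof -
  have fin: "finite ({..<p} \<rightarrow>\<^sub>E J)" using J by (intro finite_PiE) auto
  have 0: "kernel_minor K p z = 0" if z: "z \<in> ({..<p} \<rightarrow>\<^sub>E I) - ({..<p} \<rightarrow>\<^sub>E J)" for z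
  proof -
    obtain i where "i < p" "z i \<in> I - J" using z by (auto simp: PiE_iff)
    then show ?thesis using z by (intro kernel_minor_zero_row[of i] K) (auto simp: PiE_iff)
  qed
  have sub: "({..<p} \<rightarrow>\<^sub>E J) \<subseteq> ({..<p} \<rightarrow>\<^sub>E I)" using J(2) by (rule PiE_mono)
  have "(kernel_minor K p summable_on ({..<p} \<rightarrow>\<^sub>E I)) = (kernel_minor K p summable_on ({..<p} \<rightarrow>\<^sub>E J))"
    by (rule summable_on_cong_neutral) (use 0 sub in auto)
  then show "kernel_minor K p summable_on ({..<p} \<rightarrow>\<^sub>E I)" using fin by simp
  have "infsum (kernel_minor K p) ({..<p} \<rightarrow>\<^sub>E I) = infsum (kernel_minor K p) ({..<p} \<rightarrow>\<^sub>E J)"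
    by (rule infsum_cong_neutral) (use 0 sub in auto)
  then show "l2_fredholm_term I K p = fredholm_coeff (count_space J) K p"
    using fin J(1) by (simp add: l2_fredholm_term_def fredholm_coeff_count_space)
qed

text \<open>The Fredholm series of a block off-diagonal kernel has terms in even orders only; shifted by one, as in the
definition of the determinants, they sit at the odd indices \<open>2 r + 1\<close>.\<close>

lemma fredholm_series_even:
  fixes e d :: "nat \<Rightarrow> complex"
  assumes fin: "\<And>r. r > R \<Longrightarrow> e r = 0" and d: "\<And>r. d (2 * r) = e r" "\<And>r. d (2 * r + 1) = 0"
  shows "summable (\<lambda>p. e (Suc p))" "summable (\<lambda>p. d (Suc p))" "(\<Sum>p. d (Suc p)) = (\<Sum>p. e (Suc p))"
proof -
  show s: "summable (\<lambda>p. e (Suc p))"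
    by (rule summable_finite[of "{..R}"]) (auto intro: fin)
  have "(\<lambda>r. e (Suc r)) = (\<lambda>r. d (Suc (2 * r + 1)))" using d(1)[of "Suc _"] by simp
  then have "(\<lambda>r. d (Suc (2 * r + 1))) sums (\<Sum>p. e (Suc p))" using summable_sums[OF s] by simp
  then have "(\<lambda>p. d (Suc p)) sums (\<Sum>p. e (Suc p))"
  proof (subst (asm) sums_mono_reindex[where f = "\<lambda>p. d (Suc p)" and g = "\<lambda>r. 2 * r + 1"])
    show "strict_mono (\<lambda>r::nat. 2 * r + 1)" by (simp add: strict_mono_def)
    fix n :: nat assume n: "n \<notin> range (\<lambda>r. 2 * r + 1)"
    have "even n"
    proof (rule ccontr)
      assume "odd n"
      then obtain r where "n = 2 * r + 1" by (rule oddE)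
      then show False using n by auto
    qed
    then show "d (Suc n) = 0" using d(2) by (auto elim!: evenE)
  qed
  then show "summable (\<lambda>p. d (Suc p))" "(\<Sum>p. d (Suc p)) = (\<Sum>p. e (Suc p))"
    by (auto simp: sums_iff)
qed

section \<open>Block off-diagonal kernels\<close>

lemma bdd_kernel_count_space:
  assumes J: "finite J"
  shows "(\<And>n. n \<in> J \<Longrightarrow> bdd_meas N (\<lambda>x. f x n)) \<Longrightarrow> bdd_kernel N (count_space J) f"
    and "(\<And>n. n \<in> J \<Longrightarrow> bdd_meas N (h n)) \<Longrightarrow> bdd_kernel (count_space J) N h"
proof -
  have ind: "bdd_meas (count_space J) (indicator {j})" for j
    by (rule bdd_measI[where C = 1]) (auto simp: indicator_def)
  { assume f: "\<And>n. n \<in> J \<Longrightarrow> bdd_meas N (\<lambda>x. f x n)"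
    have "bdd_meas (N \<Otimes>\<^sub>M count_space J) (\<lambda>z. \<Sum>n\<in>J. indicator {n} (snd z) * f (fst z) n)"
      by (intro bdd_meas_sum bdd_meas_mult bdd_meas_compose[OF ind] bdd_meas_compose[OF f]) auto
    then show "bdd_kernel N (count_space J) f"
      by (subst bdd_meas_cong[where g = "\<lambda>z. \<Sum>n\<in>J. indicator {n} (snd z) * f (fst z) n"])
        (use J in \<open>auto simp: space_pair_measure indicator_def if_distrib[of "\<lambda>c. c * _"] cong: if_cong\<close>) }
  { assume h: "\<And>n. n \<in> J \<Longrightarrow> bdd_meas N (h n)"
    have "bdd_meas (count_space J \<Otimes>\<^sub>M N) (\<lambda>z. \<Sum>n\<in>J. indicator {n} (fst z) * h n (snd z))"
      by (intro bdd_meas_sum bdd_meas_mult bdd_meas_compose[OF ind] bdd_meas_compose[OF h]) auto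
    then show "bdd_kernel (count_space J) N h"
      by (subst bdd_meas_cong[where g = "\<lambda>z. \<Sum>n\<in>J. indicator {n} (fst z) * h n (snd z)"])
        (use J in \<open>auto simp: space_pair_measure indicator_def if_distrib[of "\<lambda>c. c * _"] cong: if_cong\<close>) }
qed

lemma kcomp_count_space:
  assumes "finite J"
  shows "kcomp (count_space J) X Y x z = (\<Sum>n\<in>J. X x n * Y n z)"
  using assms by (simp add: kcomp_def lebesgue_integral_count_space_finite)

lemma kcomp_add_orthogonal:
  assumes N: "finite_measure N" and X: "bdd_kernel M N X1" "bdd_kernel M N X2" and Y: "bdd_kernel N L Y1" "bdd_kernel N L Y2"
    and x: "x \<in> space M" and z: "z \<in> space L"
    and orth: "\<And>y. y \<in> space N \<Longrightarrow> X1 x y * Y2 y z = 0" "\<And>y. y \<in> space N \<Longrightarrow> X2 x y * Y1 y z = 0"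
  shows "kcomp N (\<lambda>x y. X1 x y + X2 x y) (\<lambda>y z. Y1 y z + Y2 y z) x z = kcomp N X1 Y1 x z + kcomp N X2 Y2 x z"
proof -
  have "kcomp N (\<lambda>x y. X1 x y + X2 x y) (\<lambda>y z. Y1 y z + Y2 y z) x z = (\<integral>y. X1 x y * Y1 y z + X2 x y * Y2 y z \<partial>N)"
    unfolding kcomp_def
    by (rule Bochner_Integration.integral_cong[OF refl]) (simp add: distrib_left distrib_right orth)
  also have "\<dots> = kcomp N X1 Y1 x z + kcomp N X2 Y2 x z"
    unfolding kcomp_def
    by (intro Bochner_Integration.integral_add bdd_meas_integrable[OF N] bdd_meas_mult
        bdd_kernel_row[OF X(1) x] bdd_kernel_row[OF X(2) x] bdd_kernel_col[OF Y(1) z] bdd_kernel_col[OF Y(2) z])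
  finally show ?thesis .
qed

text \<open>The predicate \<open>s\<close> splits the space into two blocks, and \<open>A\<close> and \<open>B\<close> map each block to the other one. Then
\<open>A A = 0\<close> and \<open>B B = 0\<close>, so that the even powers of \<open>A + B\<close> are \<open>(A B) ^ r + (B A) ^ r\<close>, whose two summands have the same
trace, and the odd powers have no diagonal.\<close>

lemma kpow_off_diagonal:
  assumes N: "finite_measure N" and A: "bdd_kernel N N A" and B: "bdd_kernel N N B"
    and A0: "\<And>x y. \<not> (s x \<and> \<not> s y) \<Longrightarrow> A x y = 0" and B0: "\<And>x y. \<not> (\<not> s x \<and> s y) \<Longrightarrow> B x y = 0"
  shows "ktrace N (kpow N (\<lambda>x y. A x y + B x y) (2 * r)) = 0"
    and "ktrace N (kpow N (\<lambda>x y. A x y + B x y) (2 * r + 1)) = 2 * ktrace N (kpow N (kcomp N A B) r)"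
proof -
  define X where "X = (\<lambda>x y. A x y + B x y)"
  have X: "bdd_kernel N N X"
    using bdd_meas_add[OF A B] by (simp add: X_def case_prod_unfold)
  have AB: "bdd_kernel N N (kcomp N A B)" and BA: "bdd_kernel N N (kcomp N B A)"
    using N A B by (auto intro: bdd_kernel_kcomp)
  have pAB: "bdd_kernel N N (kpow N (kcomp N A B) r)" and pBA: "bdd_kernel N N (kpow N (kcomp N B A) r)" for r
    using N AB BA by (auto intro: bdd_kernel_kpow)
  have "kpow N X q x z = 0" if "s x = s z \<longleftrightarrow> even q" for q x z
    using that
  proof (induction q arbitrary: x)
    case 0
    then show ?case by (auto simp: X_def A0 B0)
  next
    case (Suc q)
    have "X x y * kpow N X q y z = 0" for y
    proof (cases "s x = s y")
      case True
      then show ?thesis by (simp add: X_def A0 B0)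
    next
      case False
      then show ?thesis using Suc.IH[of y] Suc.prems by auto
    qed
    then show ?case by (simp only: kpow.simps kcomp_def Bochner_Integration.integral_zero)
  qed
  then show "ktrace N (kpow N (\<lambda>x y. A x y + B x y) (2 * r)) = 0"
    by (simp add: ktrace_def flip: X_def)
  have AB0: "kcomp N A B x z = 0" if "\<not> s x \<or> \<not> s z" for x z
  proof -
    have "A x y * B y z = 0" for y using that A0 B0 by auto
    then show ?thesis by (simp only: kcomp_def Bochner_Integration.integral_zero)
  qed
  have BA0: "kcomp N B A x z = 0" if "s x \<or> s z" for x z
  proof -
    have "B x y * A y z = 0" for y using that A0 B0 by auto
    then show ?thesis by (simp only: kcomp_def Bochner_Integration.integral_zero)
  qed
  have pAB0: "kpow N (kcomp N A B) r x z = 0" if "\<not> s x" for r x z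
    using that AB0 by (cases r) (auto simp: kcomp_def[of _ "kcomp N A B"])
  have pBA0: "kpow N (kcomp N B A) r x z = 0" if "s x" for r x z
    using that BA0 by (cases r) (auto simp: kcomp_def[of _ "kcomp N B A"])
  have XX: "kcomp N X X x z = kcomp N A B x z + kcomp N B A x z" if "x \<in> space N" "z \<in> space N" for x z
  proof -
    have "kcomp N X X x z = kcomp N (\<lambda>x y. A x y + B x y) (\<lambda>x y. B x y + A x y) x z"
      by (simp add: X_def add.commute)
    also have "\<dots> = kcomp N A B x z + kcomp N B A x z"
    proof (rule kcomp_add_orthogonal[OF N A B B A that])
      show "A x y * A y z = 0" for y using A0[of x y] A0[of y z] by (cases "s y") auto
      show "B x y * B y z = 0" for y using B0[of x y] B0[of y z] by (cases "s y") auto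
    qed
    finally show ?thesis .
  qed
  have odd: "kpow N X (2 * r + 1) x z = kpow N (kcomp N A B) r x z + kpow N (kcomp N B A) r x z"
    if "x \<in> space N" "z \<in> space N" for x z r
    using that
  proof (induction r arbitrary: x)
    case 0
    then show ?case by (simp add: XX)
  next
    case (Suc r)
    have "kpow N X (2 * Suc r + 1) x z = kcomp N X (kcomp N X (kpow N X (2 * r + 1))) x z" by simp
    also have "\<dots> = kcomp N (kcomp N X X) (kpow N X (2 * r + 1)) x z"
      by (rule kcomp_assoc[OF N N X X bdd_kernel_kpow[OF N X] Suc.prems, symmetric])
    also have "\<dots> = kcomp N (\<lambda>x z. kcomp N A B x z + kcomp N B A x z)
        (\<lambda>x z. kpow N (kcomp N A B) r x z + kpow N (kcomp N B A) r x z) x z"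
      by (rule kcomp_cong) (use Suc XX in auto)
    also have "\<dots> = kcomp N (kcomp N A B) (kpow N (kcomp N A B) r) x z
        + kcomp N (kcomp N B A) (kpow N (kcomp N B A) r) x z"
    proof (rule kcomp_add_orthogonal[OF N AB BA pAB pBA Suc.prems])
      show "kcomp N A B x y * kpow N (kcomp N B A) r y z = 0" for y
        using AB0[of x y] pBA0[of y r z] by (cases "s y") auto
      show "kcomp N B A x y * kpow N (kcomp N A B) r y z = 0" for y
        using BA0[of x y] pAB0[of y r z] by (cases "s y") auto
    qed
    finally show ?case by simp
  qed
  have "ktrace N (kpow N X (2 * r + 1))
      = (\<integral>x. kpow N (kcomp N A B) r x x + kpow N (kcomp N B A) r x x \<partial>N)"
    unfolding ktrace_def by (rule Bochner_Integration.integral_cong[OF refl]) (rule odd)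
  also have "\<dots> = ktrace N (kpow N (kcomp N A B) r) + ktrace N (kpow N (kcomp N B A) r)"
    unfolding ktrace_def
    by (intro Bochner_Integration.integral_add bdd_meas_integrable[OF N]
        bdd_kernel_compose[OF pAB] bdd_kernel_compose[OF pBA]) auto
  also have "ktrace N (kpow N (kcomp N B A) r) = ktrace N (kpow N (kcomp N A B) r)"
    by (rule ktrace_kpow_commute[OF N N B A])
  finally show "ktrace N (kpow N (\<lambda>x y. A x y + B x y) (2 * r + 1)) = 2 * ktrace N (kpow N (kcomp N A B) r)"
    by (simp add: X_def)
qed

context contour_pair
begin

text \<open>The kernel \<open>X\<close> has the off-diagonal blocks \<open>A\<close> and \<open>B\<close>. The block \<open>B\<close> need not have finite rank, but it differs from a kernel of finite rank
\<open>\<Sum> b n \<otimes> c n\<close> only by a kernel \<open>B1\<close> with \<open>A B1 = 0\<close>. Hence \<open>A B\<close> is the product of the kernels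
\<open>A b\<close> and \<open>c\<close>, whose reverse product is the finite matrix \<open>G\<close>. So the traces of powers of \<open>X\<close> are those of \<open>G\<close>,
and Newton's identities do the rest.\<close>

lemma fredholm_coeff_off_diagonal:
  fixes A B :: "complex \<Rightarrow> complex \<Rightarrow> complex" and b c :: "'n \<Rightarrow> complex \<Rightarrow> complex"
  assumes J: "finite J"
    and A: "bdd_kernel borel borel (\<lambda>x y. indicator U1 x * indicator U2 y * A x y)"
    and B: "bdd_kernel borel borel (\<lambda>x y. indicator U2 x * indicator U1 y * B x y)"
    and b: "\<And>n. n \<in> J \<Longrightarrow> bdd_meas borel (\<lambda>x. indicator U2 x * b n x)"
    and c: "\<And>n. n \<in> J \<Longrightarrow> bdd_meas borel (\<lambda>y. indicator U1 y * c n y)"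
    and annihilate: "\<And>x z. x \<in> U1 \<Longrightarrow> z \<in> U1 \<Longrightarrow>
      (\<integral>y. indicator U2 (g y) * (A x (g y) * (B (g y) z - (\<Sum>n\<in>J. b n (g y) * c n z))) * w y \<partial>N) = 0"
    and G: "\<And>n n'. n \<in> J \<Longrightarrow> n' \<in> J \<Longrightarrow> G n n' = (\<integral>x. indicator U1 (g x) * w x *
      (\<integral>y. indicator U2 (g y) * (c n (g x) * A (g x) (g y) * b n' (g y)) * w y \<partial>N) \<partial>N)"
    and X: "\<And>x y. X x y = indicator U1 x * indicator U2 y * A x y + indicator U2 x * indicator U1 y * B x y"
  shows "fredholm_coeff N (\<lambda>x y. X (g x) (g y) * w y) (2 * r) = fredholm_coeff (count_space J) G r"
    and "fredholm_coeff N (\<lambda>x y. X (g x) (g y) * w y) (2 * r + 1) = 0"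
proof -
  let ?J = "count_space J"
  define A' where "A' x y = indicator U1 (g x) * indicator U2 (g y) * A (g x) (g y) * w y" for x y
  define B' where "B' x y = indicator U2 (g x) * indicator U1 (g y) * B (g x) (g y) * w y" for x y
  define b' where "b' x n = indicator U2 (g x) * b n (g x)" for x n
  define c' where "c' n y = indicator U1 (g y) * c n (g y) * w y" for n y
  have N: "finite_measure N" by (rule finite_N)
  have finJ: "finite_measure ?J" using J by (rule finite_measure_count_space)
  have A': "bdd_kernel N N A'" and B': "bdd_kernel N N B'"
    unfolding A'_def B'_def case_prod_unfold
    by (intro bdd_meas_mult bdd_kernel_compose[OF A] bdd_kernel_compose[OF B] bdd_meas_compose[OF w]; simp)+
  have b': "bdd_kernel N ?J b'"
    unfolding b'_def by (intro bdd_kernel_count_space(1)[OF J] bdd_meas_compose[OF b g])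
  have c': "bdd_kernel ?J N c'"
    unfolding c'_def by (intro bdd_kernel_count_space(2)[OF J] bdd_meas_mult w bdd_meas_compose[OF c g])
  have bc: "bdd_kernel N N (kcomp ?J b' c')" by (rule bdd_kernel_kcomp[OF finJ b' c'])
  have A'b': "bdd_kernel N ?J (kcomp N A' b')" by (rule bdd_kernel_kcomp[OF N A' b'])
  have finite_rank: "kcomp N A' B' x z = kcomp ?J (kcomp N A' b') c' x z" if x: "x \<in> space N" and z: "z \<in> space N" for x z
  proof -
    have int: "integrable N (\<lambda>y. A' x y * Y y z)" if "bdd_kernel N N Y" for Y
      by (intro bdd_meas_integrable[OF N] bdd_meas_mult bdd_kernel_row[OF A' x] bdd_kernel_col[OF that z])
    have "kcomp N A' B' x z - kcomp N A' (kcomp ?J b' c') x z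
        = (\<integral>y. A' x y * B' y z - A' x y * kcomp ?J b' c' y z \<partial>N)"
      unfolding kcomp_def[of N] by (rule Bochner_Integration.integral_diff[OF int[OF B'] int[OF bc], symmetric])
    also have "\<dots> = (\<integral>y. indicator U1 (g x) * indicator U1 (g z) * w z *
        (indicator U2 (g y) * (A (g x) (g y) * (B (g y) (g z) - (\<Sum>n\<in>J. b n (g y) * c n (g z)))) * w y) \<partial>N)"
      by (rule Bochner_Integration.integral_cong[OF refl])
        (auto simp: kcomp_count_space[OF J] A'_def B'_def b'_def c'_def indicator_def algebra_simps
          sum_distrib_left sum_distrib_right)
    also have "\<dots> = indicator U1 (g x) * indicator U1 (g z) * w z *
        (\<integral>y. indicator U2 (g y) * (A (g x) (g y) * (B (g y) (g z) - (\<Sum>n\<in>J. b n (g y) * c n (g z)))) * w y \<partial>N)"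
      by (rule integral_mult_right_zero)
    also have "\<dots> = 0" using annihilate[of "g x" "g z"] by (cases "g x \<in> U1"; cases "g z \<in> U1") auto
    finally have "kcomp N A' B' x z = kcomp N A' (kcomp ?J b' c') x z" by simp
    also have "\<dots> = kcomp ?J (kcomp N A' b') c' x z"
      by (rule kcomp_assoc[OF N finJ A' b' c' x z, symmetric])
    finally show ?thesis .
  qed
  have G': "kcomp N c' (kcomp N A' b') n n' = G n n'" if "n \<in> J" "n' \<in> J" for n n'
  proof -
    have "c' n x * kcomp N A' b' x n' = indicator U1 (g x) * w x *
      (\<integral>y. indicator U2 (g y) * (c n (g x) * A (g x) (g y) * b n' (g y)) * w y \<partial>N)" for x
    proof -
      have "c' n x * kcomp N A' b' x n' = (\<integral>y. c' n x * (A' x y * b' y n') \<partial>N)"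
        unfolding kcomp_def by (rule integral_mult_right_zero[symmetric])
      also have "\<dots> = (\<integral>y. indicator U1 (g x) * w x *
          (indicator U2 (g y) * (c n (g x) * A (g x) (g y) * b n' (g y)) * w y) \<partial>N)"
        by (rule Bochner_Integration.integral_cong[OF refl])
          (auto simp: A'_def b'_def c'_def indicator_def)
      also have "\<dots> = indicator U1 (g x) * w x *
          (\<integral>y. indicator U2 (g y) * (c n (g x) * A (g x) (g y) * b n' (g y)) * w y \<partial>N)"
        by (rule integral_mult_right_zero)
      finally show ?thesis .
    qed
    then show ?thesis unfolding kcomp_def[of N c'] G[OF that] by (simp only:)
  qed
  have trace: "ktrace N (kpow N (kcomp N A' B') r) = ktrace ?J (kpow ?J G r)" for r
  proof -
    have "ktrace N (kpow N (kcomp N A' B') r) = ktrace N (kpow N (kcomp ?J (kcomp N A' b') c') r)"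
      by (intro ktrace_cong kpow_cong finite_rank)
    also have "\<dots> = ktrace ?J (kpow ?J (kcomp N c' (kcomp N A' b')) r)"
      by (rule ktrace_kpow_commute[OF N finJ A'b' c'])
    also have "\<dots> = ktrace ?J (kpow ?J G r)"
      by (rule ktrace_cong, rule kpow_cong) (auto simp: G')
    finally show ?thesis .
  qed
  have X': "(\<lambda>x y. X (g x) (g y) * w y) = (\<lambda>x y. A' x y + B' x y)"
    unfolding X A'_def B'_def by (simp add: fun_eq_iff distrib_right)
  have A0: "A' x y = 0" if "\<not> (g x \<in> U1 \<and> \<not> g y \<in> U1)" for x y
    using that U(3) by (auto simp: A'_def indicator_def)
  have B0: "B' x y = 0" if "\<not> (\<not> g x \<in> U1 \<and> g y \<in> U1)" for x y
    using that U(3) by (auto simp: B'_def indicator_def)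
  have bddX: "bdd_kernel N N (\<lambda>x y. A' x y + B' x y)"
    using bdd_meas_add[OF A' B'] by (simp add: case_prod_unfold)
  have bddG: "bdd_kernel ?J ?J G"
    by (rule bdd_kernel_count_space(1)[OF J], rule bdd_measI[where C = "Max ((\<lambda>(n, n'). norm (G n n')) ` (J \<times> J))"])
      (use J in \<open>auto intro!: Max_ge\<close>)
  note off = kpow_off_diagonal[OF N A' B', of "\<lambda>x. g x \<in> U1", OF A0 B0, unfolded trace]
  show "fredholm_coeff N (\<lambda>x y. X (g x) (g y) * w y) (2 * r) = fredholm_coeff (count_space J) G r"
    "fredholm_coeff N (\<lambda>x y. X (g x) (g y) * w y) (2 * r + 1) = 0"
    unfolding X' using fredholm_coeff_even_traces[OF N bddX finJ bddG off] by auto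
qed

end

section \<open>The weight \<open>W\<close> and the kernel \<open>K\<close>\<close>

text \<open>The reciprocal of \<open>W\<close> as a function that is visibly holomorphic away from \<open>0\<close>.\<close>

definition W_inv :: "real \<Rightarrow> nat \<Rightarrow> nat \<Rightarrow> complex \<Rightarrow> complex" where
  "W_inv a N m u = (u - of_real a) ^ (N - m + 1) * (1 + of_real a * u) ^ m / u ^ (N - m)"

lemma divide_W_eq_times_W_inv: "x / W a N m u = x * W_inv a N m u"
  by (simp add: W_def W_inv_def)

lemma W_denominator_nonzero:
  assumes "a \<noteq> 0" "z \<noteq> complex_of_real a" "z \<noteq> complex_of_real (- 1 / a)"
  shows "(z - of_real a) ^ (N - m + 1) * (1 + of_real a * z) ^ m \<noteq> 0"
proof -
  have "1 + of_real a * z \<noteq> 0"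
  proof
    assume "1 + of_real a * z = 0"
    then have "of_real a * z = -1" by (simp add: add_eq_0_iff)
    then have "z = -1 / of_real a" using assms(1) by (simp add: field_simps)
    then show False using assms(3) by simp
  qed
  then show ?thesis using assms(2) by simp
qed

lemma holomorphic_on_W:
  assumes "a \<noteq> 0" "complex_of_real a \<notin> S" "complex_of_real (- 1 / a) \<notin> S"
  shows "W a N m holomorphic_on S"
  unfolding W_def[abs_def] using W_denominator_nonzero[OF assms(1)] assms(2,3)
  by (intro holomorphic_intros) metis

lemma holomorphic_on_W_inv: "0 \<notin> S \<Longrightarrow> W_inv a N m holomorphic_on S"
  unfolding W_inv_def[abs_def] by (intro holomorphic_intros) auto

lemma tendsto_quotient_at_infinity: "((\<lambda>u. u / (u - v)) \<longlongrightarrow> (1 :: complex)) at_infinity"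
proof -
  have "((\<lambda>u. 1 / (1 - v / u)) \<longlongrightarrow> 1 / (1 - 0)) at_infinity"
    by (intro tendsto_intros tendsto_divide_0[OF tendsto_const] filterlim_ident) auto
  moreover have "eventually (\<lambda>u. 1 / (1 - v / u) = u / (u - v)) at_infinity"
    using eventually_not_equal_at_infinity[of 0] by eventually_elim (simp add: field_simps)
  ultimately show ?thesis by (auto elim: Lim_transform_eventually)
qed

text \<open>The degree of \<open>1 / W\<close> at infinity is \<open>m + 1\<close>. This number decides which contour integrals in \<open>u\<close> vanish.\<close>

lemma tendsto_W_inv: "((\<lambda>u. W_inv a N m u / u ^ (m + 1)) \<longlongrightarrow> of_real a ^ m) at_infinity"
proof -
  have inv: "((\<lambda>u::complex. x / u) \<longlongrightarrow> 0) at_infinity" for x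
    by (rule tendsto_divide_0[OF tendsto_const filterlim_ident])
  have "((\<lambda>u::complex. (1 - of_real a / u) ^ (N - m + 1) * (1 / u + of_real a) ^ m)
      \<longlongrightarrow> (1 - 0) ^ (N - m + 1) * (0 + of_real a) ^ m) at_infinity"
    by (intro tendsto_intros inv)
  moreover have "eventually (\<lambda>u::complex. (1 - of_real a / u) ^ (N - m + 1) * (1 / u + of_real a) ^ m
      = W_inv a N m u / u ^ (m + 1)) at_infinity"
    using eventually_not_equal_at_infinity[of 0]
  proof eventually_elim
    fix u :: complex assume u: "u \<noteq> 0"
    have "1 - of_real a / u = (u - of_real a) / u" "1 / u + of_real a = (1 + of_real a * u) / u"
      using u by (simp_all add: field_simps)
    then show "(1 - of_real a / u) ^ (N - m + 1) * (1 / u + of_real a) ^ m = W_inv a N m u / u ^ (m + 1)"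
      using u by (simp add: W_inv_def power_divide field_simps)
  qed
  ultimately show ?thesis by (auto elim: Lim_transform_eventually)
qed

lemma geometric_remainder:
  fixes u v :: complex
  assumes "u \<noteq> 0" "u \<noteq> v"
  shows "1 / (u - v) = (\<Sum>j<J. v ^ j / u ^ (j + 1)) + (v / u) ^ J / (u - v)"
proof (induction J)
  case (Suc J)
  have "(v / u) ^ J / (u - v) = v ^ J / u ^ (J + 1) + (v / u) ^ Suc J / (u - v)"
    using assms by (simp add: power_divide field_simps)
  then show ?case using Suc by simp
qed simp

text \<open>The \<open>u\<close>-integral of \<open>K n n'\<close>: its integrand is of order \<open>u ^ (m - n - 1)\<close> at infinity. So all rows of \<open>K\<close> with \<open>n > m\<close> vanish.\<close>

lemma contour_integral_K_row_eq_0: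
  assumes \<gamma>: "positive_contour \<gamma>" and 0: "0 \<in> inside (path_image \<gamma>)" and v: "v \<in> inside (path_image \<gamma>)"
    and n: "m < n"
  shows "contour_integral \<gamma> (\<lambda>u. c * W_inv a N m u / (u ^ (n + 1) * (u - v))) = 0"
proof (rule contour_integral_eq_0_of_decay[OF \<gamma>, where pts = "{0, v}"])
  show "(\<lambda>u. c * W_inv a N m u / (u ^ (n + 1) * (u - v))) holomorphic_on - {0, v}"
    by (intro holomorphic_intros holomorphic_on_W_inv) auto
  have "((\<lambda>u. c * (W_inv a N m u / u ^ (m + 1)) * (u / (u - v)) * (1 / u) ^ (n - m))
      \<longlongrightarrow> c * of_real a ^ m * 1 * 0 ^ (n - m)) at_infinity"
    by (intro tendsto_intros tendsto_W_inv tendsto_quotient_at_infinity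
        tendsto_divide_0[OF tendsto_const] filterlim_ident)
  moreover have "eventually (\<lambda>u. c * (W_inv a N m u / u ^ (m + 1)) * (u / (u - v)) * (1 / u) ^ (n - m)
      = u * (c * W_inv a N m u / (u ^ (n + 1) * (u - v)))) at_infinity"
    using eventually_not_equal_at_infinity[of 0]
  proof eventually_elim
    fix u :: complex assume u: "u \<noteq> 0"
    have "u ^ n = u ^ m * u ^ (n - m)" using n by (simp flip: power_add)
    then show "c * (W_inv a N m u / u ^ (m + 1)) * (u / (u - v)) * (1 / u) ^ (n - m)
      = u * (c * W_inv a N m u / (u ^ (n + 1) * (u - v)))"
      using u by (simp add: power_divide)
  qed
  ultimately have "((\<lambda>u. u * (c * W_inv a N m u / (u ^ (n + 1) * (u - v))))
      \<longlongrightarrow> c * of_real a ^ m * 1 * 0 ^ (n - m)) at_infinity"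
    by (rule Lim_transform_eventually)
  moreover have "c * of_real a ^ m * 1 * 0 ^ (n - m) = 0" using n by simp
  ultimately show "((\<lambda>u. u * (c * W_inv a N m u / (u ^ (n + 1) * (u - v)))) \<longlongrightarrow> 0) at_infinity"
    by (simp only:)
qed (use 0 v in auto)

text \<open>The \<open>u\<close>-integral of the product of \<open>(v / u) ^ k / (v - u)\<close> with the remainder term \<open>(x / u) ^ (m + 1 - k) / (W u (u - x))\<close> of the
geometric expansion, up to constants; the number of terms of the expansion is chosen to make the integrand of order \<open>u\<^sup>-\<^sup>2\<close>.\<close>

lemma contour_integral_remainder_eq_0:
  assumes \<gamma>: "positive_contour \<gamma>" and 0: "0 \<in> inside (path_image \<gamma>)"
    and v: "v \<in> inside (path_image \<gamma>)" and x: "x \<in> inside (path_image \<gamma>)"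
  shows "contour_integral \<gamma> (\<lambda>u. c * W_inv a N m u / (u ^ (m + 1) * (u - v) * (u - x))) = 0"
proof (rule contour_integral_eq_0_of_decay[OF \<gamma>, where pts = "{0, v, x}"])
  show "(\<lambda>u. c * W_inv a N m u / (u ^ (m + 1) * (u - v) * (u - x))) holomorphic_on - {0, v, x}"
    by (intro holomorphic_intros holomorphic_on_W_inv) auto
  have "((\<lambda>u. c * (W_inv a N m u / u ^ (m + 1)) * (u / (u - v)) * (u / (u - x)) * (1 / u))
      \<longlongrightarrow> c * of_real a ^ m * 1 * 1 * 0) at_infinity"
    by (intro tendsto_intros tendsto_W_inv tendsto_quotient_at_infinity
        tendsto_divide_0[OF tendsto_const] filterlim_ident)
  moreover have "eventually (\<lambda>u. c * (W_inv a N m u / u ^ (m + 1)) * (u / (u - v)) * (u / (u - x)) * (1 / u)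
      = u * (c * W_inv a N m u / (u ^ (m + 1) * (u - v) * (u - x)))) at_infinity"
    using eventually_not_equal_at_infinity[of 0] by eventually_elim simp
  ultimately show "((\<lambda>u. u * (c * W_inv a N m u / (u ^ (m + 1) * (u - v) * (u - x)))) \<longlongrightarrow> 0) at_infinity"
    by (auto elim: Lim_transform_eventually)
qed (use 0 v x in auto)

lemma K_kernel_integrand:
  assumes "0 \<le> n" "0 \<le> n'"
  shows "u powi (- n - 1) * v powi n' / (u - v) * (W a N m v / W a N m u)
    = v ^ nat n' * W a N m v * W_inv a N m u / (u ^ (nat n + 1) * (u - v))"
proof -
  have "nat (n + 1) = nat n + 1" using assms(1) by simp
  then have "u powi (- n - 1) = inverse (u ^ (nat n + 1))"
    using assms(1) by (simp add: power_int_def power_inverse add.commute)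
  moreover have "v powi n' = v ^ nat n'" using assms(2) by (simp add: power_int_def)
  ultimately show ?thesis by (simp only: divide_W_eq_times_W_inv) (simp add: field_simps)
qed

section \<open>The two determinants\<close>

theorem proposition1p8:
  fixes a :: real and N m k :: nat and \<gamma>1 \<gamma>2 :: "real \<Rightarrow> complex"
  assumes "0 < a" and "a \<le> 1"
    and "N \<ge> 1" and "m \<in> {1..N}" and "k \<in> {1..m + 1}"
    and "positive_contour \<gamma>1"
    and "complex_of_real a \<in> inside (path_image \<gamma>1)"
    and "complex_of_real (- 1 / a) \<in> outside (path_image \<gamma>1)"
    and "positive_contour \<gamma>2"
    and "path_image \<gamma>1 \<subseteq> inside (path_image \<gamma>2)"
    and "0 \<in> inside (path_image \<gamma>2)"
    and "path_image \<gamma>1 \<inter> path_image \<gamma>2 = {}"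
  shows "l2_fredholm_convergent {int k..} (K_kernel \<gamma>1 \<gamma>2 a N m) \<and>
         L2_fredholm_convergent [\<gamma>1, \<gamma>2] (M_kernel \<gamma>1 \<gamma>2 a N m k) \<and>
         l2_fredholm_det {int k..} (K_kernel \<gamma>1 \<gamma>2 a N m)
           = L2_fredholm_det [\<gamma>1, \<gamma>2] (M_kernel \<gamma>1 \<gamma>2 a N m k)"
proof -
  let ?S1 = "path_image \<gamma>1" and ?S2 = "path_image \<gamma>2"
  let ?W = "W a N m" and ?V = "W_inv a N m" and ?K = "K_kernel \<gamma>1 \<gamma>2 a N m" and ?M = "M_kernel \<gamma>1 \<gamma>2 a N m k"
  let ?c = "2 * of_real pi * \<i> :: complex"
  define J where "J = {int k..int m}"
  note pos2 = \<open>positive_contour \<gamma>2\<close> and zero = \<open>0 \<in> inside ?S2\<close>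
  have a: "a \<noteq> 0" using \<open>0 < a\<close> by simp
  have \<gamma>1: "valid_path \<gamma>1" "pathfinish \<gamma>1 = pathstart \<gamma>1" and \<gamma>2: "valid_path \<gamma>2" "pathfinish \<gamma>2 = pathstart \<gamma>2"
    using assms(6,9) by (auto simp: positive_contour_def)
  have S1: "compact ?S1" and S2: "compact ?S2"
    using \<gamma>1 \<gamma>2 by (auto intro: compact_valid_path_image)
  \<comment> \<open>Compact neighbourhoods of the contours that stay disjoint and avoid the poles of the kernels, so
    that the kernels are bounded on them. \<open>K1\<close> stays inside \<open>\<gamma>2\<close>, since the points of \<open>U1\<close> become poles of
    integrands in \<open>u\<close> that have to be enclosed by \<open>\<gamma>2\<close>.\<close>
  obtain U1 K1 where U1: "open U1" "compact K1" "?S1 \<subseteq> U1" "U1 \<subseteq> K1"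
      "K1 \<subseteq> inside ?S2 - {complex_of_real a, complex_of_real (- 1 / a)}"
  proof (rule compact_neighbourhood[OF S1 path_image_nonempty])
    show "open (inside ?S2 - {complex_of_real a, complex_of_real (- 1 / a)})"
      using S2 by (intro open_Diff open_inside finite_imp_closed compact_imp_closed) auto
    show "?S1 \<subseteq> inside ?S2 - {complex_of_real a, complex_of_real (- 1 / a)}"
      using assms(7,8,10) inside_no_overlap[of ?S1] outside_no_overlap[of ?S1] by blast
  qed
  obtain U2 K2 where U2: "open U2" "compact K2" "?S2 \<subseteq> U2" "U2 \<subseteq> K2" "K2 \<subseteq> - K1 - {0}"
  proof (rule compact_neighbourhood[OF S2 path_image_nonempty])
    show "open (- K1 - {0})" using U1(2) by (intro open_Diff open_Compl compact_imp_closed) auto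
    show "?S2 \<subseteq> - K1 - {0}" using U1(5) zero inside_no_overlap[of ?S2] by blast
  qed
  have disj: "U1 \<inter> U2 = {}" using U1(4) U2(4,5) by blast
  obtain \<mu> :: "(bool \<times> real) measure" and g w where "contour_pair \<gamma>1 \<gamma>2 U1 U2 \<mu> g w"
    using contour_pair_exists[OF \<gamma>1 \<gamma>2 U1(1) U2(1) disj U1(3) U2(3)] by blast
  then interpret contour_pair \<gamma>1 \<gamma>2 U1 U2 \<mu> g w .
  have U1_inside: "v \<in> inside ?S2" if "v \<in> U1" for v using that U1(4,5) by blast
  have K2_nz: "u \<noteq> 0" if "u \<in> K2" for u using that U2(5) by blast
  have K12: "u \<noteq> v" if "u \<in> K2" "v \<in> K1" for u v using that U2(5) by blast
  have nz: "u \<noteq> 0" if "u \<in> U2" for u using that U2(4) K2_nz by blast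
  have ne: "u \<noteq> v" if "u \<in> U2" "v \<in> U1" for u v using that U1(4) U2(4) K12 by blast
  have W_hol: "?W holomorphic_on S" if "S \<subseteq> K1" for S
    using that U1(5) by (intro holomorphic_on_W a) auto
  have V_hol: "?V holomorphic_on S" if "S \<subseteq> K2" for S
    using that K2_nz by (intro holomorphic_on_W_inv) auto
  have W_cont: "continuous_on K1 ?W" and V_cont: "continuous_on K2 ?V"
    using W_hol[of K1] V_hol[of K2] by (auto intro: holomorphic_on_imp_continuous_on)

  \<comment> \<open>the kernel \<open>K\<close>\<close>
  \<comment> \<open>The integrand of \<open>K p q\<close>, without the constant factor.\<close>
  define f where "f p q = (\<lambda>u v. v ^ q * ?W v * ?V u / (u ^ (p + 1) * (u - v)))" for p q :: nat
  have K_eq: "?K n n' = 1 / ?c ^ 2 * contour_integral \<gamma>2 (\<lambda>u. contour_integral \<gamma>1 (f (nat n) (nat n') u))"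
    if "0 \<le> n" "0 \<le> n'" for n n'
    unfolding K_kernel_def K_kernel_integrand[OF that] f_def ..
  have f_bdd: "bdd_kernel borel borel (\<lambda>u v. indicator U2 u * indicator U1 v * f p q u v)" for p q
  proof (rule bdd_kernel_continuous[OF U2(1) U1(1) U2(4) U1(4) U2(2) U1(2)])
    show "continuous_on (K2 \<times> K1) (\<lambda>(u, v). f p q u v)"
      unfolding f_def case_prod_unfold
      by (intro continuous_intros continuous_on_compose2[OF W_cont] continuous_on_compose2[OF V_cont])
        (use K2_nz K12 in auto)
  qed
  have f_left: "(\<lambda>u. f p q u v) holomorphic_on U2" if "v \<in> U1" for p q v
    unfolding f_def using nz ne that U2(4) by (intro holomorphic_intros V_hol) auto
  have f_right: "f p q u holomorphic_on U1" if "u \<in> U2" for p q u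
    unfolding f_def using nz ne that U1(4) by (intro holomorphic_intros W_hol) auto
  have iterated: "contour_integral \<gamma>2 (\<lambda>u. contour_integral \<gamma>1 (f p q u))
      = (\<integral>x. indicator U1 (g x) * w x * (\<integral>y. indicator U2 (g y) * f p q (g y) (g x) * w y \<partial>\<mu>) \<partial>\<mu>)"
    "contour_integral \<gamma>2 (\<lambda>u. contour_integral \<gamma>1 (f p q u))
      = (\<integral>x. indicator U1 (g x) * w x * contour_integral \<gamma>2 (\<lambda>u. f p q u (g x)) \<partial>\<mu>)" for p q
    by (rule iterated_contour_integral[OF f_bdd f_left f_right]; assumption)+

  have K_zero: "?K n n' = 0" if "n \<in> {int k..} - J" "n' \<in> {int k..}" for n n'
  proof -
    have n: "m < nat n" "0 \<le> n" "0 \<le> n'" using that by (auto simp: J_def)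
    have "indicator U1 (g x) * w x * contour_integral \<gamma>2 (\<lambda>u. f (nat n) (nat n') u (g x)) = 0" for x
    proof (cases "g x \<in> U1")
      case True
      then show ?thesis
        using contour_integral_K_row_eq_0[OF pos2 zero U1_inside[OF True] n(1)] by (simp add: f_def)
    qed simp
    then have "contour_integral \<gamma>2 (\<lambda>u. contour_integral \<gamma>1 (f (nat n) (nat n') u)) = 0"
      unfolding iterated(2) by (simp only: Bochner_Integration.integral_zero)
    then show ?thesis unfolding K_eq[OF n(2,3)] by simp
  qed

  \<comment> \<open>the kernel \<open>M\<close>\<close>
  \<comment> \<open>The blocks of \<open>M\<close>. The functions \<open>b n\<close> and \<open>d n\<close> come from the first \<open>m + 1 - k\<close> terms of the geometric
    expansion of \<open>1 / (u - v)\<close> in \<open>B u v\<close>, the term \<open>v ^ j / u ^ (j + 1)\<close> having the label \<open>n = k + j\<close>.\<close>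
  define A where "A v u = (v / u) ^ k / (?c * (v - u))" for v u
  define B where "B u v = - (?W v * ?V u) / (?c * (u - v))" for u v
  define b where "b n u = - ?V u / (?c * u ^ (nat (n - int k) + 1))" for n u
  define d where "d n v = v ^ nat (n - int k) * ?W v" for n v
  \<comment> \<open>The extension of \<open>M\<close> to the neighbourhoods of the contours.\<close>
  define X where "X x y = indicator U1 x * indicator U2 y * A x y + indicator U2 x * indicator U1 y * B x y" for x y
  have A_bdd: "bdd_kernel borel borel (\<lambda>x y. indicator U1 x * indicator U2 y * A x y)"
  proof (rule bdd_kernel_continuous[OF U1(1) U2(1) U1(4) U2(4) U1(2) U2(2)])
    show "continuous_on (K1 \<times> K2) (\<lambda>(v, u). A v u)"
      unfolding A_def case_prod_unfold using K2_nz K12 by (intro continuous_intros) auto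
  qed
  have B_bdd: "bdd_kernel borel borel (\<lambda>x y. indicator U2 x * indicator U1 y * B x y)"
  proof (rule bdd_kernel_continuous[OF U2(1) U1(1) U2(4) U1(4) U2(2) U1(2)])
    show "continuous_on (K2 \<times> K1) (\<lambda>(u, v). B u v)"
      unfolding B_def case_prod_unfold
      by (intro continuous_intros continuous_on_compose2[OF W_cont] continuous_on_compose2[OF V_cont])
        (use K12 in auto)
  qed
  have X_bdd: "bdd_kernel borel borel X"
    using bdd_meas_add[OF A_bdd B_bdd] by (simp add: X_def case_prod_unfold)
  have A_left: "(\<lambda>v. A v u) holomorphic_on U1" if "u \<in> U2" for u
    unfolding A_def using nz[OF that] ne[OF that] by (intro holomorphic_intros) auto
  have A_right: "A v holomorphic_on U2" if "v \<in> U1" for v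
    unfolding A_def using nz ne[OF _ that] by (intro holomorphic_intros) auto
  have B_left: "(\<lambda>u. B u v) holomorphic_on U2" if "v \<in> U1" for v
    unfolding B_def using ne[OF _ that] U2(4) by (intro holomorphic_intros V_hol) auto
  have B_right: "B u holomorphic_on U1" if "u \<in> U2" for u
    unfolding B_def using ne[OF that] U1(4) by (intro holomorphic_intros W_hol) auto
  have X_cases: "X x y = (if x \<in> U1 \<and> y \<in> U2 then A x y else if x \<in> U2 \<and> y \<in> U1 then B x y else 0)" for x y
    using disj by (auto simp: X_def indicator_def)
  have X_left: "(\<lambda>v. X v y) holomorphic_on U1 \<union> U2" if "y \<in> U1 \<union> U2" for y
  proof (rule holomorphic_on_Un)
    show "(\<lambda>v. X v y) holomorphic_on U1"
    proof (cases "y \<in> U2")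
      case True
      then show ?thesis by (intro holomorphic_transform[OF A_left[of y]]) (auto simp: X_cases)
    next
      case False
      then show ?thesis using disj by (intro holomorphic_transform[OF holomorphic_on_const[of 0]]) (auto simp: X_cases)
    qed
    show "(\<lambda>v. X v y) holomorphic_on U2"
    proof (cases "y \<in> U1")
      case True
      then show ?thesis using disj by (intro holomorphic_transform[OF B_left[of y]]) (auto simp: X_cases)
    next
      case False
      then show ?thesis using disj by (intro holomorphic_transform[OF holomorphic_on_const[of 0]]) (auto simp: X_cases)
    qed
  qed (use U1 U2 in auto)
  have X_right: "(\<lambda>v. X x v) holomorphic_on U1 \<union> U2" if "x \<in> U1 \<union> U2" for x
  proof (rule holomorphic_on_Un)
    show "(\<lambda>v. X x v) holomorphic_on U2"
    proof (cases "x \<in> U1")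
      case True
      then show ?thesis by (intro holomorphic_transform[OF A_right[of x]]) (auto simp: X_cases)
    next
      case False
      then show ?thesis using disj by (intro holomorphic_transform[OF holomorphic_on_const[of 0]]) (auto simp: X_cases)
    qed
    show "(\<lambda>v. X x v) holomorphic_on U1"
    proof (cases "x \<in> U2")
      case True
      then show ?thesis using disj by (intro holomorphic_transform[OF B_right[of x]]) (auto simp: X_cases)
    next
      case False
      then show ?thesis using disj by (intro holomorphic_transform[OF holomorphic_on_const[of 0]]) (auto simp: X_cases)
    qed
  qed (use U1 U2 in auto)
  have X_diag: "(\<lambda>v. X v v) holomorphic_on U1 \<union> U2"
    using disj by (intro holomorphic_transform[OF holomorphic_on_const[of 0]]) (auto simp: X_cases)
  have M_eq: "?M x y = X x y" if "x \<in> ?S1 \<union> ?S2" "y \<in> ?S1 \<union> ?S2" for x y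
  proof -
    have S: "z \<in> ?S1 \<longleftrightarrow> z \<in> U1" "z \<in> ?S2 \<longleftrightarrow> z \<in> U2" if "z \<in> ?S1 \<union> ?S2" for z
      using that U1(3) U2(3) disj by auto
    show ?thesis using disj S[OF that(1)] S[OF that(2)] that
      by (auto simp: M_kernel_def X_cases A_def B_def divide_W_eq_times_W_inv indicator_def)
  qed
  obtain C where C: "\<And>x y. norm (X x y) \<le> C"
    using X_bdd by (auto simp: bdd_meas_def space_pair_measure)
  have X_meas: "(\<lambda>(x, y). X x y) \<in> borel_measurable (borel \<Otimes>\<^sub>M borel)"
    using X_bdd by (simp add: bdd_meas_def)
  have L2: "contours_power_integrable [\<gamma>1, \<gamma>2] p (kernel_minor ?M p)"
    "L2_fredholm_term [\<gamma>1, \<gamma>2] ?M p = fredholm_coeff \<mu> (\<lambda>x y. X (g x) (g y) * w y) p" for p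
    by (rule L2_fredholm_term_eq_fredholm_coeff[OF X_meas C X_left X_right X_diag M_eq]; assumption)+

  have annihilate: "(\<integral>y. indicator U2 (g y) * (A x (g y) * (B (g y) z - (\<Sum>n\<in>J. b n (g y) * d n z))) * w y \<partial>\<mu>) = 0"
    if x: "x \<in> U1" and z: "z \<in> U1" for x z
  proof -
    let ?h = "\<lambda>u. A x u * (B u z - (\<Sum>n\<in>J. b n u * d n z))"
    have "?h holomorphic_on U2"
      unfolding b_def d_def using nz U2(4)
      by (intro holomorphic_intros A_right[OF x] B_left[OF z] V_hol) auto
    then have "(\<integral>y. indicator U2 (g y) * ?h (g y) * w y \<partial>\<mu>) = contour_integral \<gamma>2 ?h"
      by (rule integral2[symmetric])
    also have "\<dots> = contour_integral \<gamma>2 (\<lambda>u. (x ^ k * z ^ (m + 1 - k) * ?W z / ?c ^ 2) * ?V u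
        / (u ^ (m + 1) * (u - x) * (u - z)))"
    proof (rule contour_integral_eq)
      fix u assume "u \<in> ?S2"
      then have u: "u \<in> U2" using U2(3) by auto
      \<comment> \<open>The label \<open>n = k + j\<close> runs through \<open>J\<close> as \<open>j\<close> runs through \<open>0, \<dots>, m - k\<close>; for \<open>k = m + 1\<close>
        both ranges are empty.\<close>
      have sum: "(\<Sum>n\<in>J. z ^ nat (n - int k) / u ^ (nat (n - int k) + 1)) = (\<Sum>j<m + 1 - k. z ^ j / u ^ (j + 1))"
        by (rule sum.reindex_bij_witness[of _ "\<lambda>j. int (j + k)" "\<lambda>n. nat (n - int k)"]) (auto simp: J_def)
      have bd: "(\<Sum>n\<in>J. b n u * d n z) = - (?W z * ?V u / ?c) * (\<Sum>j<m + 1 - k. z ^ j / u ^ (j + 1))"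
        unfolding b_def d_def sum[symmetric] sum_distrib_left by (rule sum.cong) (simp_all add: field_simps)
      have "B u z = - (?W z * ?V u / ?c) * (1 / (u - z))" by (simp add: B_def)
      then have "B u z - (\<Sum>n\<in>J. b n u * d n z) = - (?W z * ?V u / ?c) * ((z / u) ^ (m + 1 - k) / (u - z))"
        unfolding bd geometric_remainder[OF nz[OF u] ne[OF u z], of "m + 1 - k"]
        by (simp only: distrib_left add_diff_cancel_left')
      then have "?h u = (x / u) ^ k / (?c * (x - u)) * (- (?W z * ?V u / ?c) * ((z / u) ^ (m + 1 - k) / (u - z)))"
        unfolding A_def by simp
      also have "\<dots> = (x / u) ^ k / (?c * (u - x)) * ((?W z * ?V u / ?c) * ((z / u) ^ (m + 1 - k) / (u - z)))"
      proof -
        have "?c * (x - u) = - (?c * (u - x))" by (simp add: algebra_simps)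
        then show ?thesis by (simp only: divide_minus_right mult_minus_left mult_minus_right minus_minus)
      qed
      also have "\<dots> = (x ^ k * z ^ (m + 1 - k) * ?W z / ?c ^ 2) * ?V u / (u ^ k * u ^ (m + 1 - k) * (u - x) * (u - z))"
        by (simp add: power_divide power2_eq_square mult_ac)
      also have "u ^ k * u ^ (m + 1 - k) = u ^ (m + 1)"
        using assms(5) by (simp flip: power_add)
      finally show "?h u = (x ^ k * z ^ (m + 1 - k) * ?W z / ?c ^ 2) * ?V u / (u ^ (m + 1) * (u - x) * (u - z))" .
    qed
    also have "\<dots> = 0" by (rule contour_integral_remainder_eq_0[OF pos2 zero U1_inside[OF x] U1_inside[OF z]])
    finally show ?thesis .
  qed

  \<comment> \<open>The matrix that arises from the finite-rank part is the transpose of the block of \<open>K\<close>.\<close>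
  have G: "?K n' n = (\<integral>x. indicator U1 (g x) * w x *
      (\<integral>y. indicator U2 (g y) * (d n (g x) * A (g x) (g y) * b n' (g y)) * w y \<partial>\<mu>) \<partial>\<mu>)"
    if n: "n \<in> J" and n': "n' \<in> J" for n n'
  proof -
    define F where "F = f (nat n') (nat n)"
    have F: "1 / ?c ^ 2 * F u v = d n v * A v u * b n' u" if u: "u \<in> U2" and v: "v \<in> U1" for u v
    proof -
      have e: "nat n = nat (n - int k) + k" "nat n' = nat (n' - int k) + k" using n n' by (auto simp: J_def)
      have "A v u = - ((v / u) ^ k / (?c * (u - v)))"
      proof -
        have "?c * (v - u) = - (?c * (u - v))" by (simp add: algebra_simps)
        then show ?thesis unfolding A_def by (simp only: divide_minus_right)
      qed
      then show ?thesis
        unfolding F_def f_def d_def b_def e by (simp add: power_add power_divide power2_eq_square mult_ac)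
    qed
    have "?K n' n = 1 / ?c ^ 2 * (\<integral>x. indicator U1 (g x) * w x * (\<integral>y. indicator U2 (g y) * F (g y) (g x) * w y \<partial>\<mu>) \<partial>\<mu>)"
      using K_eq[of n' n] n n' unfolding iterated(1) F_def by (auto simp: J_def)
    also have "\<dots> = (\<integral>x. 1 / ?c ^ 2 * (indicator U1 (g x) * w x * (\<integral>y. indicator U2 (g y) * F (g y) (g x) * w y \<partial>\<mu>)) \<partial>\<mu>)"
      by (rule integral_mult_right_zero[symmetric])
    also have "\<dots> = (\<integral>x. indicator U1 (g x) * w x *
      (\<integral>y. indicator U2 (g y) * (d n (g x) * A (g x) (g y) * b n' (g y)) * w y \<partial>\<mu>) \<partial>\<mu>)"
    proof (rule Bochner_Integration.integral_cong[OF refl])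
      fix x
      have eq: "1 / ?c ^ 2 * (\<integral>y. indicator U2 (g y) * F (g y) (g x) * w y \<partial>\<mu>)
          = (\<integral>y. indicator U2 (g y) * (d n (g x) * A (g x) (g y) * b n' (g y)) * w y \<partial>\<mu>)"
        if "g x \<in> U1"
      proof -
        have "1 / ?c ^ 2 * (\<integral>y. indicator U2 (g y) * F (g y) (g x) * w y \<partial>\<mu>)
          = (\<integral>y. 1 / ?c ^ 2 * (indicator U2 (g y) * F (g y) (g x) * w y) \<partial>\<mu>)"
          by (rule integral_mult_right_zero[symmetric])
        also have "\<dots> = (\<integral>y. indicator U2 (g y) * (d n (g x) * A (g x) (g y) * b n' (g y)) * w y \<partial>\<mu>)"
        proof (rule Bochner_Integration.integral_cong[OF refl])
          fix y
          show "1 / ?c ^ 2 * (indicator U2 (g y) * F (g y) (g x) * w y)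
            = indicator U2 (g y) * (d n (g x) * A (g x) (g y) * b n' (g y)) * w y"
          proof (cases "g y \<in> U2")
            case True
            show ?thesis unfolding F[OF True that, symmetric] by (simp only: mult_ac)
          qed simp
        qed
        finally show ?thesis .
      qed
      show "1 / ?c ^ 2 * (indicator U1 (g x) * w x * (\<integral>y. indicator U2 (g y) * F (g y) (g x) * w y \<partial>\<mu>))
        = indicator U1 (g x) * w x *
          (\<integral>y. indicator U2 (g y) * (d n (g x) * A (g x) (g y) * b n' (g y)) * w y \<partial>\<mu>)"
      proof (cases "g x \<in> U1")
        case True
        with eq show ?thesis by (simp only: mult.left_commute)
      qed simp
    qed
    finally show ?thesis .
  qed

  have compact_bound: "\<exists>C. \<forall>z\<in>S. norm (h z) \<le> C" if "compact S" "continuous_on S h"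
    for S and h :: "complex \<Rightarrow> complex"
    using compact_imp_bounded[OF compact_continuous_image[OF that(2,1)]] by (auto simp: bounded_iff)
  have b_bdd: "bdd_meas borel (\<lambda>x. indicator U2 x * b n x)" for n
  proof -
    have "b n holomorphic_on K2"
      unfolding b_def using K2_nz by (intro holomorphic_intros V_hol) auto
    with compact_bound[OF U2(2)] obtain C where "\<forall>z\<in>K2. norm (b n z) \<le> C"
      using holomorphic_on_imp_continuous_on by blast
    then show ?thesis using U2(4) \<open>b n holomorphic_on K2\<close> holomorphic_on_subset
      by (intro bdd_meas_holomorphic[OF U2(1), where C = C]) blast+
  qed
  have d_bdd: "bdd_meas borel (\<lambda>x. indicator U1 x * d n x)" for n
  proof -
    have "d n holomorphic_on K1"
      unfolding d_def by (intro holomorphic_intros W_hol) auto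
    with compact_bound[OF U1(2)] obtain C where "\<forall>z\<in>K1. norm (d n z) \<le> C"
      using holomorphic_on_imp_continuous_on by blast
    then show ?thesis using U1(4) \<open>d n holomorphic_on K1\<close> holomorphic_on_subset
      by (intro bdd_meas_holomorphic[OF U1(1), where C = C]) blast+
  qed
  have J: "finite J" "J \<subseteq> {int k..}" by (auto simp: J_def)
  have off: "fredholm_coeff \<mu> (\<lambda>x y. X (g x) (g y) * w y) (2 * r) = fredholm_coeff (count_space J) (\<lambda>n n'. ?K n' n) r"
    "fredholm_coeff \<mu> (\<lambda>x y. X (g x) (g y) * w y) (2 * r + 1) = 0" for r
    by (rule fredholm_coeff_off_diagonal[OF J(1) A_bdd B_bdd b_bdd d_bdd annihilate G X_def]; assumption)+
  have transpose: "fredholm_coeff (count_space J) (\<lambda>n n'. ?K n' n) r = fredholm_coeff (count_space J) ?K r" for r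
    unfolding fredholm_coeff_count_space[OF J(1)] kernel_minor_transpose[of ?K] ..
  have l2: "kernel_minor ?K p summable_on ({..<p} \<rightarrow>\<^sub>E {int k..})"
    "l2_fredholm_term {int k..} ?K p = fredholm_coeff (count_space J) ?K p" for p
    by (rule l2_fredholm_term_finite[OF J K_zero]; assumption)+
  have even: "L2_fredholm_term [\<gamma>1, \<gamma>2] ?M (2 * r) = l2_fredholm_term {int k..} ?K r"
    and odd: "L2_fredholm_term [\<gamma>1, \<gamma>2] ?M (2 * r + 1) = 0" for r
    unfolding L2(2) l2(2) using off[of r] transpose[of r] by simp_all
  have vanish: "l2_fredholm_term {int k..} ?K r = 0" if "r > card J" for r
    unfolding l2(2) by (rule fredholm_coeff_count_space_eq_0[OF J(1) that])
  have series: "summable (\<lambda>p. l2_fredholm_term {int k..} ?K (Suc p))"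
    "summable (\<lambda>p. L2_fredholm_term [\<gamma>1, \<gamma>2] ?M (Suc p))"
    "(\<Sum>p. L2_fredholm_term [\<gamma>1, \<gamma>2] ?M (Suc p)) = (\<Sum>p. l2_fredholm_term {int k..} ?K (Suc p))"
    by (rule fredholm_series_even[OF vanish even odd]; assumption)+
  show ?thesis
    unfolding l2_fredholm_convergent_def L2_fredholm_convergent_def l2_fredholm_det_def L2_fredholm_det_def
    using series L2(1) l2(1) by simp
qed

end
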